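(* Let $\mathcal{K}$ be a finite nonempty set of nonnegative $N\times N$ matrices that satisfies the product property and all of whose members have positive spectral radius. Let $\lambda$ be the spectral radius and $\nu$ the degree of a $\preceq$-minimal matrix for $\mathcal{K}$, and let $\{S_0,S_1,\ldots,S_\nu\}$ be the principal $\preceq$-minimal partition of $S=\{1,\ldots,N\}$ with respect to $\mathcal{K}$. Then there exist nonnegative vectors $v^{(1)},v^{(2)},\ldots,v^{(\nu)}\in\mathbb{R}^N$ such that \[ \min_{A\in\mathcal{K}} Av^{(\nu)}=\lambda v^{(\nu)},\qquad \min_{A\in\mathcal{K}} Av^{(i)}=\lambda v^{(i)}+v^{(i+1)},\quad i=\nu-1,\ldots,2,1 . \] Moreover, for each $i=1,\ldots,\nu$, \[ v^{(i)}_j>0\ \text{ for } j\in\bigcup_{k=i}^{\nu}S_k\quad\text{and}\quad v^{(i)}_j=0\ \text{ for } j\in\bigcup_{k=0}^{i-1}S_k . \]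
   Context: All vector inequalities and minima of vectors are component-wise; a vector $v$ is strictly positive ($v>0$) if all its components are positive. $S=\{1,\ldots,N\}$ is the state space; for $S_1,S_2\subset S$, $A|_{(S_1,S_2)}$ is the restriction of $A$ to $S_1\times S_2$; $spr(A)$ is the spectral radius. Product property: $\mathcal{K}$ satisfies the product property if for every $V\subseteq S$ and all $A,B\in\mathcal{K}$, the matrix whose $i$th row is the $i$th row of $A$ for $i\in V$ and the $i$th row of $B$ for $i\in S\setminus V$ belongs to $\mathcal{K}$. Growth: for sequences $a_n,b_n$ of nonnegative numbers (or nonnegative vectors of the same dimension), $a_n\preceq b_n$ means that there is a constant $q>0$ with $a_n\le q\,b_n$ for all $n$ large enough. $\preceq$-minimal: $B\in\mathcal{K}$ is $\preceq$-minimal for $\mathcal{K}$ if $B^nv\preceq A^nv$ for all $A\in\mathcal{K}$ and all $v>0$. Such matrices exist, and all of them have the same spectral radius, degree and principal partition (defined below), so $\lambda$, $\nu$ and the partition below are well defined. Principal partition of a nonnegative matrix $A$: state $i$ has access to state $j$ if $(A^n)_{ij}>0$ for some integer $n\ge 0$; a matrix is irreducible if any two states have access to each other. A class of $A$ is a maximal subset $C\subset S$ such that $A|_{(C,C)}$ is irreducible; the classes partition $S$. A class $C$ is basic if $spr(A|_{(C,C)})=spr(A)$. A class $C$ has access to a class $C'$ if some (equivalently any) state of $C$ has access to some (equivalently any) state of $C'$. A chain of classes is an ordered collection of (pairwise distinct) classes $C_1,\ldots,C_n$ such that $C_i$ has access to $C_{i+1}$ for $i=1,\ldots,n-1$; its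 length is the number of basic classes it contains. The depth of a class $C$ is the length of the longest chain starting with $C$; the degree $\nu(A)$ is the length of the longest chain of $A$. $S_i$ is the union of all classes of depth $i$, and $\{S_0,S_1,\ldots,S_{\nu(A)}\}$ is the principal partition of $S$ with respect to $A$ ($S_0$ may be empty). The principal $\preceq$-minimal partition of $S$ with respect to $\mathcal{K}$ is the principal partition of a $\preceq$-minimal matrix for $\mathcal{K}$. *)

theory Defs
  imports
    Complex_Main
    "Jordan_Normal_Form.Spectral_Radius"
    "Jordan_Normal_Form.DL_Submatrix"
begin

(* The state space {1,...,N} is rendered as the index set {..<N} of N x N matrices. *)

definition nonneg_vec :: "real vec \<Rightarrow> bool" where
  "nonneg_vec v \<longleftrightarrow> 0\<^sub>v (dim_vec v) \<le> v"

(* The library order < on vectors only means "\<le> and not \<ge>", so it is not used here. *)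
definition strictly_pos_vec :: "real vec \<Rightarrow> bool" where
  "strictly_pos_vec v \<longleftrightarrow> (\<forall>i<dim_vec v. 0 < v $ i)"

definition nonneg_matrix :: "real mat \<Rightarrow> bool" where
  "nonneg_matrix A \<longleftrightarrow> 0\<^sub>m (dim_row A) (dim_col A) \<le> A"

definition spr :: "real mat \<Rightarrow> real" where
  "spr A = spectral_radius (map_mat complex_of_real A)"

definition product_property :: "nat \<Rightarrow> real mat set \<Rightarrow> bool" where
  "product_property N K \<longleftrightarrow>
     (\<forall>V\<subseteq>{..<N}. \<forall>A\<in>K. \<forall>B\<in>K.
        mat N N (\<lambda>(i, j). if i \<in> V then A $$ (i, j) else B $$ (i, j)) \<in> K)"

definition growth_le :: "(nat \<Rightarrow> real vec) \<Rightarrow> (nat \<Rightarrow> real vec) \<Rightarrow> bool" where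
  "growth_le a b \<longleftrightarrow> (\<exists>q>0. \<forall>\<^sub>F n in sequentially. a n \<le> q \<cdot>\<^sub>v b n)"

definition growth_minimal :: "nat \<Rightarrow> real mat set \<Rightarrow> real mat \<Rightarrow> bool" where
  "growth_minimal N K B \<longleftrightarrow> B \<in> K \<and>
     (\<forall>A\<in>K. \<forall>v\<in>carrier_vec N. strictly_pos_vec v \<longrightarrow>
        growth_le (\<lambda>n. B ^\<^sub>m n *\<^sub>v v) (\<lambda>n. A ^\<^sub>m n *\<^sub>v v))"

(* Componentwise minimum; Min is meant for finite nonempty K. *)
definition min_mult_vec :: "nat \<Rightarrow> real mat set \<Rightarrow> real vec \<Rightarrow> real vec" where
  "min_mult_vec N K v = vec N (\<lambda>j. Min ((\<lambda>A. (A *\<^sub>v v) $ j) ` K))"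

definition has_access :: "real mat \<Rightarrow> nat \<Rightarrow> nat \<Rightarrow> bool" where
  "has_access A i j \<longleftrightarrow> (\<exists>n. 0 < (A ^\<^sub>m n) $$ (i, j))"

definition irreducible_matrix :: "real mat \<Rightarrow> bool" where
  "irreducible_matrix A \<longleftrightarrow> (\<forall>i<dim_row A. \<forall>j<dim_row A. has_access A i j)"

definition is_class :: "real mat \<Rightarrow> nat set \<Rightarrow> bool" where
  "is_class A C \<longleftrightarrow>
     C \<subseteq> {..<dim_row A} \<and> irreducible_matrix (submatrix A C C) \<and>
     (\<forall>D. C \<subset> D \<and> D \<subseteq> {..<dim_row A} \<longrightarrow> \<not> irreducible_matrix (submatrix A D D))"

definition basic_class :: "real mat \<Rightarrow> nat set \<Rightarrow> bool" where
  "basic_class A C \<longleftrightarrow> is_class A C \<and> spr (submatrix A C C) = spr A"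

definition class_access :: "real mat \<Rightarrow> nat set \<Rightarrow> nat set \<Rightarrow> bool" where
  "class_access A C D \<longleftrightarrow> (\<exists>i\<in>C. \<exists>j\<in>D. has_access A i j)"

definition class_chain :: "real mat \<Rightarrow> nat set list \<Rightarrow> bool" where
  "class_chain A Cs \<longleftrightarrow> Cs \<noteq> [] \<and> distinct Cs \<and> (\<forall>C\<in>set Cs. is_class A C) \<and>
     (\<forall>i. Suc i < length Cs \<longrightarrow> class_access A (Cs ! i) (Cs ! Suc i))"

(* The length of a chain counts only its basic classes. *)
definition chain_length :: "real mat \<Rightarrow> nat set list \<Rightarrow> nat" where
  "chain_length A Cs = length (filter (basic_class A) Cs)"

(* Chains consist of distinct subsets of a finite set, so the maxima below
   range over finite sets. *)
definition class_depth :: "real mat \<Rightarrow> nat set \<Rightarrow> nat" where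
  "class_depth A C = Max {chain_length A Cs |Cs. class_chain A Cs \<and> hd Cs = C}"

definition degree_mat :: "real mat \<Rightarrow> nat" where
  "degree_mat A = Max {chain_length A Cs |Cs. class_chain A Cs}"

definition principal_part :: "real mat \<Rightarrow> nat \<Rightarrow> nat set" where
  "principal_part A i = \<Union>{C. is_class A C \<and> class_depth A C = i}"

end

(* For r > lambda = spr B value iteration gives the least solution x(r) of r x = 1 + min_A A x. It lies
   below the resolvent s(r) = sum_k B^k 1 / r^(k+1), and minimality of B bounds it below by a constant
   multiple of s(r). Multiplying the equation r s = 1 + B s on a class by its positive left Perron
   vector shows that s_i(lambda + e) is of exact order e^(-k) as e -> 0+ for every state i of depth k,
   and hence so is x_i(lambda + e).

   Since K is finite, one A in K attains the minimum along a sequence e_n -> 0+. With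
   q = det (r - A), the adjugate of r - A shows that p = q x is a vector of polynomials in e = r - lambda,
   and (lambda + e - A) p = q 1. If q vanishes to order m at e = 0, the coefficients of p
   of index m - 1, m - 2, ... form a chain of generalized eigenvectors of A, on which A is only
   lexicographically minimal. Dividing p by 1 - M e keeps the chain relations and, for M large, turns
   lexicographic into componentwise minimality and leading coefficients into positive entries. *)
theory Submission
  imports Defs "Jordan_Normal_Form.Jordan_Normal_Form_Existence"
begin

section \<open>Powers and resolvent of a nonnegative matrix\<close>

text \<open>\<open>A\<close> is known to minimise only along a sequence, and x only up to its order
  of magnitude. Polynomials make both sufficient: near 0 a polynomial has the sign of its lowest
  coefficient, and any positive sequence tending to 0 detects it. Since x_i has order e^(-d_i),
  where d_i is the depth of i, p_i starts at index m - d_i. The k-th vector is therefore read off at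
  index m - k, and its support is the set of states of depth at least k. Division by 1 - M e is
  multiplication by the power series with coefficients M^j: it commutes with lambda + e - A, and q /
  (1 - M e) still vanishes to order m, so the relations below index m survive, while for large M the
  first nonzero coefficient outweighs all later ones. Multiplying p and q by e^nu beforehand makes m
  >= nu immediate, so that the indices m - k are genuine. Minimality of B enters through a
  comparison of B^k 1 with A^k 1 and gives the lower bound on x; the upper bound rests on B being a
  member of K.\<close>

lemma times_mat_entry:
  assumes "A \<in> carrier_mat n m" "B \<in> carrier_mat m l" "i < n" "j < l"
  shows "(A * B) $$ (i, j) = (\<Sum>k<m. A $$ (i, k) * B $$ (k, j))"
  using assms by (auto simp: scalar_prod_def atLeast0LessThan)

lemma mult_mat_vec_entry:
  assumes "A \<in> carrier_mat n m" "v \<in> carrier_vec m" "i < n"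
  shows "(A *\<^sub>v v) $ i = (\<Sum>k<m. A $$ (i, k) * v $ k)"
  using assms by (auto simp: scalar_prod_def atLeast0LessThan)

lemma pow_mat_Suc_left:
  assumes "A \<in> carrier_mat n n"
  shows "A ^\<^sub>m Suc k = A * A ^\<^sub>m k"
proof (induction k)
  case 0
  then show ?case using assms by auto
next
  case (Suc k)
  have "A ^\<^sub>m Suc (Suc k) = (A * A ^\<^sub>m k) * A" using Suc by simp
  also have "\<dots> = A * (A ^\<^sub>m k * A)"
    by (rule assoc_mult_mat[OF assms pow_carrier_mat[OF assms] assms])
  finally show ?case by simp
qed

lemma pow_mat_Suc_entry:
  assumes "A \<in> carrier_mat n n" "i < n" "j < n"
  shows "(A ^\<^sub>m Suc k) $$ (i, j) = (\<Sum>l<n. (A ^\<^sub>m k) $$ (i, l) * A $$ (l, j))"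
  using times_mat_entry[OF pow_carrier_mat[OF assms(1)] assms(1) assms(2,3)] by simp

lemma pow_mat_Suc_entry_left:
  assumes "A \<in> carrier_mat n n" "i < n" "j < n"
  shows "(A ^\<^sub>m Suc k) $$ (i, j) = (\<Sum>l<n. A $$ (i, l) * (A ^\<^sub>m k) $$ (l, j))"
  unfolding pow_mat_Suc_left[OF assms(1)]
  by (rule times_mat_entry[OF assms(1) pow_carrier_mat[OF assms(1)] assms(2,3)])

lemma nonneg_matrix_iff:
  assumes "A \<in> carrier_mat n m"
  shows "nonneg_matrix A \<longleftrightarrow> (\<forall>i<n. \<forall>j<m. 0 \<le> A $$ (i, j))"
  using assms unfolding nonneg_matrix_def by (auto simp: less_eq_mat_def)

lemma nonneg_matrixD:
  assumes "A \<in> carrier_mat n m" "nonneg_matrix A" "i < n" "j < m"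
  shows "0 \<le> A $$ (i, j)"
  using assms nonneg_matrix_iff by blast

lemma pow_mat_entry_nonneg:
  fixes A :: "real mat"
  assumes "A \<in> carrier_mat n n" "nonneg_matrix A" "i < n" "j < n"
  shows "0 \<le> (A ^\<^sub>m k) $$ (i, j)"
  using assms(3,4)
proof (induction k arbitrary: i j)
  case 0
  then show ?case using assms by auto
next
  case (Suc k)
  then show ?case unfolding pow_mat_Suc_entry[OF assms(1) Suc.prems]
    using nonneg_matrixD[OF assms(1,2)] by (auto intro!: sum_nonneg mult_nonneg_nonneg)
qed

lemma pow_smult_mat:
  fixes A :: "'a::comm_ring_1 mat"
  assumes "A \<in> carrier_mat n n"
  shows "(a \<cdot>\<^sub>m A) ^\<^sub>m k = a ^ k \<cdot>\<^sub>m (A ^\<^sub>m k)"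
proof (induction k)
  case 0
  then show ?case using assms by auto
next
  case (Suc k)
  show ?case
    by (rule eq_matI) (use assms Suc pow_carrier_mat[OF assms, of k] in auto)
qed

section \<open>Geometric bounds on powers from the spectral radius\<close>

lemma spectral_radius_nonneg:
  assumes "A \<in> carrier_mat n n" "0 < n"
  shows "0 \<le> spectral_radius A"
  using spectral_radius_mem_max(1)[OF assms] by auto

lemma spectral_radius_smult_lt_1:
  assumes A: "A \<in> carrier_mat n n" and n: "0 < n" and R: "spectral_radius A < R"
  shows "spectral_radius (complex_of_real (1 / R) \<cdot>\<^sub>m A) < 1"
proof -
  let ?B = "complex_of_real (1 / R) \<cdot>\<^sub>m A"
  have B: "?B \<in> carrier_mat n n" using A by auto
  have R0: "0 < R" using spectral_radius_nonneg[OF A n] R by auto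
  from spectral_radius_mem_max(1)[OF B n] obtain e where
    e: "e \<in> spectrum ?B" "spectral_radius ?B = norm e" by auto
  then obtain v where v: "eigenvector ?B v e" unfolding spectrum_def eigenvalue_def by auto
  then have v': "v \<in> carrier_vec n" "v \<noteq> 0\<^sub>v n" "?B *\<^sub>v v = e \<cdot>\<^sub>v v"
    using B unfolding eigenvector_def by auto
  have "A *\<^sub>v v = (of_real R * e) \<cdot>\<^sub>v v"
  proof (rule eq_vecI)
    fix i assume i: "i < dim_vec ((of_real R * e) \<cdot>\<^sub>v v)"
    then have i: "i < n" using v' by auto
    have "(?B *\<^sub>v v) $ i = e * v $ i" using v' i by auto
    moreover have "(?B *\<^sub>v v) $ i = of_real (1/R) * (A *\<^sub>v v) $ i"
      using i A v'(1) by (simp add: scalar_prod_def sum_distrib_left mult.assoc)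
    ultimately show "(A *\<^sub>v v) $ i = ((of_real R * e) \<cdot>\<^sub>v v) $ i"
      using R0 i v'(1) by (simp add: field_simps)
  qed (use A v' in auto)
  then have "eigenvector A v (of_real R * e)" using v' A unfolding eigenvector_def by auto
  then have "norm (of_real R * e) \<in> norm ` spectrum A"
    unfolding spectrum_def eigenvalue_def by blast
  from spectral_radius_mem_max(2)[OF A n this] have "R * norm e \<le> spectral_radius A"
    using R0 by (simp add: norm_mult)
  with R have "R * norm e < R * 1" by linarith
  then have "norm e < 1" using R0 by (simp only: mult_less_cancel_left_pos)
  then show ?thesis using e by simp
qed

text \<open>Scaling by \<open>1 / R\<close> brings the spectral radius below 1, where the Jordan
  normal form bounds all powers uniformly; undoing the scaling produces the factor
  \<open>R ^ k\<close>.\<close>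

lemma pow_mat_entry_bound:
  fixes A :: "real mat"
  assumes A: "A \<in> carrier_mat n n" and n: "0 < n" and R: "spr A < R"
  shows "\<exists>c\<ge>0. \<forall>k i j. i < n \<longrightarrow> j < n \<longrightarrow> \<bar>(A ^\<^sub>m k) $$ (i, j)\<bar> \<le> c * R ^ k"
proof -
  let ?C = "map_mat complex_of_real A"
  let ?B = "complex_of_real (1 / R) \<cdot>\<^sub>m ?C"
  have C: "?C \<in> carrier_mat n n" and B: "?B \<in> carrier_mat n n" using A by auto
  have sr: "spectral_radius ?B < 1"
    using spectral_radius_smult_lt_1[OF C n] R unfolding spr_def by auto
  have R0: "0 < R" using spectral_radius_nonneg[OF C n] R unfolding spr_def by auto
  have "\<exists>as. jordan_nf ?B as"
    using jordan_nf_exists[OF B] char_poly_factorized[OF B] by metis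
  from spectral_radius_jnf_norm_bound_less_1[OF B sr this]
  obtain c where c: "\<And>k. norm_bound (?B ^\<^sub>m k) c" by auto
  have *: "\<bar>(A ^\<^sub>m k) $$ (i, j)\<bar> \<le> c * R ^ k" if "i < n" "j < n" for i j k
  proof -
    have "?B ^\<^sub>m k = of_real (1 / R) ^ k \<cdot>\<^sub>m (map_mat of_real (A ^\<^sub>m k))"
      unfolding pow_smult_mat[OF C] of_real_hom.mat_hom_pow[OF A] ..
    then have e: "(?B ^\<^sub>m k) $$ (i, j) = of_real (1 / R) ^ k * of_real ((A ^\<^sub>m k) $$ (i, j))"
      using that A by (simp only: index_smult_mat index_map_mat pow_mat_dim_square[OF A])
    have dim: "dim_row (?B ^\<^sub>m k) = n" "dim_col (?B ^\<^sub>m k) = n"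
      using pow_mat_dim_square[OF B] by auto
    have "norm ((?B ^\<^sub>m k) $$ (i, j)) \<le> c"
      using c[of k] that unfolding norm_bound_def dim by blast
    then have "(1 / R) ^ k * \<bar>(A ^\<^sub>m k) $$ (i, j)\<bar> \<le> c"
      unfolding e using R0 by (simp add: norm_mult norm_power norm_divide)
    then show ?thesis using R0 by (simp add: field_simps)
  qed
  from *[OF n n, of 0] have "0 \<le> c" by auto
  then show ?thesis using * by blast
qed

section \<open>Row sums of powers and of the resolvent\<close>

definition pow_rowsum :: "real mat \<Rightarrow> nat \<Rightarrow> nat \<Rightarrow> real" where
  "pow_rowsum A k i = (\<Sum>j<dim_row A. (A ^\<^sub>m k) $$ (i, j))"

text \<open>Component \<open>i\<close> of (r - A)^(-1) 1 as a Neumann series,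
  \<open>pow_rowsum A k i\<close> being component \<open>i\<close> of A^k 1. The value is used only
  for \<open>r > spr A\<close>, where the series converges.\<close>

definition resolvent_rowsum :: "real mat \<Rightarrow> real \<Rightarrow> nat \<Rightarrow> real" where
  "resolvent_rowsum A r i = (\<Sum>k. pow_rowsum A k i / r ^ Suc k)"

lemma pow_rowsum_0:
  assumes "A \<in> carrier_mat n n" "i < n"
  shows "pow_rowsum A 0 i = 1"
proof -
  have "pow_rowsum A 0 i = (\<Sum>j<n. if i = j then 1 else 0)"
    unfolding pow_rowsum_def using assms by (auto intro!: sum.cong)
  then show ?thesis using assms by simp
qed

lemma pow_rowsum_Suc:
  assumes "A \<in> carrier_mat n n" "i < n"
  shows "pow_rowsum A (Suc k) i = (\<Sum>j<n. A $$ (i, j) * pow_rowsum A k j)"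
proof -
  have "pow_rowsum A (Suc k) i = (\<Sum>j<n. \<Sum>l<n. A $$ (i, l) * (A ^\<^sub>m k) $$ (l, j))"
    unfolding pow_rowsum_def using assms pow_mat_Suc_entry_left[OF assms(1,2)]
    by (auto intro!: sum.cong)
  also have "\<dots> = (\<Sum>l<n. A $$ (i, l) * pow_rowsum A k l)"
    unfolding pow_rowsum_def sum_distrib_left using assms by (subst sum.swap) auto
  finally show ?thesis .
qed

context
  fixes A :: "real mat" and n :: nat
  assumes A: "A \<in> carrier_mat n n" and A0: "nonneg_matrix A"
    and n0: "0 < n"
begin

lemma spr_nonneg: "0 \<le> spr A"
  unfolding spr_def by (rule spectral_radius_nonneg[of _ n]) (use A n0 in auto)

lemma pow_rowsum_nonneg: "i < n \<Longrightarrow> 0 \<le> pow_rowsum A k i"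
  unfolding pow_rowsum_def using A by (auto intro!: sum_nonneg pow_mat_entry_nonneg[OF A A0])

text \<open>A rate \<open>R\<close> strictly between \<open>spr A\<close> and \<open>r\<close>
  leaves room for comparison with a geometric series of ratio \<open>R / r\<close>, although the
  powers of \<open>A\<close> may exceed \<open>spr A ^ k\<close> by a polynomial factor.\<close>

lemma resolvent_summable:
  assumes r: "spr A < r" and i: "i < n"
  shows "summable (\<lambda>k. pow_rowsum A k i / r ^ Suc k)"
proof -
  obtain R where R: "spr A < R" "R < r" using dense r by blast
  have R0: "0 \<le> R" using spr_nonneg R by simp
  obtain c where c: "0 \<le> c"
    "\<And>k i j. i < n \<Longrightarrow> j < n \<Longrightarrow> \<bar>(A ^\<^sub>m k) $$ (i, j)\<bar> \<le> c * R ^ k"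
    using pow_mat_entry_bound[OF A n0 R(1)] by blast
  show ?thesis
  proof (rule summable_comparison_test'[of "\<lambda>k. real n * c / r * (R / r) ^ k" 0])
    show "summable (\<lambda>k. real n * c / r * (R / r) ^ k)"
      by (intro summable_mult summable_geometric) (use R R0 in auto)
    fix k
    have "pow_rowsum A k i \<le> of_nat (card {..<n}) * (c * R ^ k)"
      unfolding pow_rowsum_def carrier_matD(1)[OF A]
      by (rule sum_bounded_above) (use c(2)[OF i] in \<open>auto simp: abs_le_iff\<close>)
    then have "pow_rowsum A k i / r ^ Suc k \<le> real n * (c * R ^ k) / r ^ Suc k"
      using R R0 by (intro divide_right_mono) auto
    then show "norm (pow_rowsum A k i / r ^ Suc k) \<le> real n * c / r * (R / r) ^ k"
      using pow_rowsum_nonneg[OF i] R R0 by (simp add: power_divide mult_ac)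
  qed
qed

lemma resolvent_rowsum_eq:
  assumes r: "spr A < r" and i: "i < n"
  shows "r * resolvent_rowsum A r i = 1 + (\<Sum>j<n. A $$ (i, j) * resolvent_rowsum A r j)"
proof -
  have r0: "0 < r" using spr_nonneg r by simp
  let ?f = "\<lambda>i k. pow_rowsum A k i / r ^ Suc k"
  have "resolvent_rowsum A r i = ?f i 0 + (\<Sum>k. ?f i (Suc k))"
    unfolding resolvent_rowsum_def using suminf_split_head[OF resolvent_summable[OF r i]] by simp
  also have "(\<Sum>k. ?f i (Suc k)) = (\<Sum>k. \<Sum>j<n. A $$ (i, j) * ?f j k / r)"
    by (simp only: pow_rowsum_Suc[OF A i] sum_divide_distrib power_Suc2 times_divide_eq_right divide_divide_eq_left)
  also have "\<dots> = (\<Sum>j<n. \<Sum>k. A $$ (i, j) * ?f j k / r)"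
    by (rule suminf_sum) (intro summable_divide summable_mult resolvent_summable[OF r], simp)
  also have "\<dots> = (\<Sum>j<n. A $$ (i, j) * resolvent_rowsum A r j / r)"
  proof (rule sum.cong[OF refl])
    fix j assume "j \<in> {..<n}"
    then have "?f j sums resolvent_rowsum A r j"
      unfolding resolvent_rowsum_def using resolvent_summable[OF r] by (intro summable_sums) auto
    from sums_divide[OF sums_mult[OF this, of "A $$ (i, j)"], of r]
    show "(\<Sum>k. A $$ (i, j) * ?f j k / r) = A $$ (i, j) * resolvent_rowsum A r j / r"
      by (rule sums_unique[symmetric])
  qed
  also have "?f i 0 = 1 / r" using pow_rowsum_0[OF A i] by simp
  finally have "resolvent_rowsum A r i = 1 / r + (\<Sum>j<n. A $$ (i, j) * resolvent_rowsum A r j) / r"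
    by (simp only: sum_divide_distrib)
  then show ?thesis using r0 by (simp add: field_simps)
qed

lemma resolvent_rowsum_ge_partial:
  assumes r: "spr A < r" and i: "i < n"
  shows "(\<Sum>k<m. pow_rowsum A k i / r ^ Suc k) \<le> resolvent_rowsum A r i"
  unfolding resolvent_rowsum_def
  using spr_nonneg r pow_rowsum_nonneg[OF i]
  by (intro sum_le_suminf resolvent_summable[OF r i]) auto

lemma resolvent_rowsum_pos:
  assumes r: "spr A < r" and i: "i < n"
  shows "1 / r \<le> resolvent_rowsum A r i" "0 < resolvent_rowsum A r i"
proof -
  have r0: "0 < r" using spr_nonneg r by simp
  show "1 / r \<le> resolvent_rowsum A r i"
    using resolvent_rowsum_ge_partial[OF r i, of 1] pow_rowsum_0[OF A i] by simp
  moreover have "0 < 1 / r" using r0 by simp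
  ultimately show "0 < resolvent_rowsum A r i" by linarith
qed

end

section \<open>Perron vectors\<close>

text \<open>Bolzano-Weierstrass in \<open>n\<close> coordinates: the subsequence is refined one
  coordinate at a time, each time to a monotone and hence convergent one.\<close>

lemma bounded_family_convergent_subsequence:
  fixes f :: "nat \<Rightarrow> nat \<Rightarrow> real"
  assumes "\<And>k i. i < n \<Longrightarrow> \<bar>f k i\<bar> \<le> c"
  shows "\<exists>r l. strict_mono (r :: nat \<Rightarrow> nat) \<and> (\<forall>i<n. (\<lambda>k. f (r k) i) \<longlonglongrightarrow> l i)"
  using assms
proof (induction n)
  case 0
  then show ?case by (intro exI[of _ id]) (auto simp: strict_mono_def)
next
  case (Suc n)
  then obtain r l where r: "strict_mono (r :: nat \<Rightarrow> nat)" "\<And>i. i < n \<Longrightarrow> (\<lambda>k. f (r k) i) \<longlonglongrightarrow> l i"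
    by fastforce
  obtain g where g: "strict_mono (g :: nat \<Rightarrow> nat)" "monoseq (\<lambda>k. f (r (g k)) n)"
    using seq_monosub[of "\<lambda>k. f (r k) n"] by auto
  have "Bseq (\<lambda>k. f (r (g k)) n)"
    by (rule BseqI'[of _ c]) (use Suc.prems in auto)
  with g(2) have "convergent (\<lambda>k. f (r (g k)) n)" by (simp add: Bseq_monoseq_convergent)
  then obtain x where x: "(\<lambda>k. f (r (g k)) n) \<longlonglongrightarrow> x" unfolding convergent_def by auto
  have "(\<lambda>k. f ((r \<circ> g) k) i) \<longlonglongrightarrow> (l(n := x)) i" if "i < Suc n" for i
  proof (cases "i = n")
    case False
    with that have "i < n" by simp
    from LIMSEQ_subseq_LIMSEQ[OF r(2)[OF this] g(1)] show ?thesis using False by (simp add: o_def)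
  qed (use x in simp)
  moreover have "strict_mono (r \<circ> g)" using r(1) g(1) by (rule strict_mono_o)
  ultimately show ?case by blast
qed

lemma spr_eigenvector:
  assumes A: "A \<in> carrier_mat n n" and n0: "0 < n"
  obtains w :: "nat \<Rightarrow> complex" and e i0
  where "spr A = norm e" "i0 < n" "w i0 \<noteq> 0"
    "\<And>i. i < n \<Longrightarrow> (\<Sum>j<n. of_real (A $$ (i, j)) * w j) = e * w i"
proof -
  let ?C = "map_mat complex_of_real A"
  have C: "?C \<in> carrier_mat n n" using A by auto
  obtain e where e: "e \<in> spectrum ?C" "spr A = norm e"
    using spectral_radius_mem_max(1)[OF C n0] unfolding spr_def by auto
  then obtain v where "eigenvector ?C v e" unfolding spectrum_def eigenvalue_def by auto
  then have v: "v \<in> carrier_vec n" "v \<noteq> 0\<^sub>v n" "?C *\<^sub>v v = e \<cdot>\<^sub>v v"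
    using C unfolding eigenvector_def by auto
  from v(1,2) obtain i0 where i0: "i0 < n" "v $ i0 \<noteq> 0"
    by (metis carrier_vecD eq_vecI index_zero_vec)
  have "(\<Sum>j<n. of_real (A $$ (i, j)) * v $ j) = e * v $ i" if "i < n" for i
  proof -
    have "(\<Sum>j<n. of_real (A $$ (i, j)) * v $ j) = (?C *\<^sub>v v) $ i"
      using mult_mat_vec_entry[OF C v(1) that] A that by simp
    then show ?thesis using v that by simp
  qed
  with that e(2) i0 show ?thesis by blast
qed

context
  fixes A :: "real mat" and n :: nat
  assumes A: "A \<in> carrier_mat n n" and A0: "nonneg_matrix A"
    and n0: "0 < n"
begin

text \<open>Moduli in an eigenvector equation of maximal modulus give spr(A) |w| <= A |w|, hence
  spr(A)^k |w| <= A^k |w| <= c A^k 1. At a coordinate where w does not vanish the Neumann series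
  thus dominates a geometric series with sum of order 1 / (r - spr A).\<close>

lemma resolvent_rowsum_blowup:
  "\<exists>c>0. \<exists>i<n. \<forall>r>spr A. c / (r - spr A) \<le> resolvent_rowsum A r i"
proof -
  obtain w :: "nat \<Rightarrow> complex" and e i0 where w: "spr A = norm e" "i0 < n" "w i0 \<noteq> 0"
    "\<And>i. i < n \<Longrightarrow> (\<Sum>j<n. of_real (A $$ (i, j)) * w j) = e * w i"
    using spr_eigenvector[OF A n0] by metis
  define c where "c = (\<Sum>i<n. norm (w i))"
  have wc: "norm (w i) \<le> c" if "i < n" for i
    unfolding c_def using that by (intro member_le_sum) auto
  have c0: "0 < c" using wc[OF w(2)] w(3) by (meson less_le_trans zero_less_norm_iff)
  have pw: "spr A ^ k * norm (w i) \<le> c * pow_rowsum A k i" if "i < n" for k i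
    using that
  proof (induction k arbitrary: i)
    case 0
    then show ?case using wc pow_rowsum_0[OF A] by simp
  next
    case (Suc k)
    have "spr A ^ Suc k * norm (w i) = spr A ^ k * norm (\<Sum>j<n. of_real (A $$ (i, j)) * w j)"
      using w(1,4) Suc.prems by (simp add: norm_mult mult_ac)
    also have "\<dots> \<le> spr A ^ k * (\<Sum>j<n. A $$ (i, j) * norm (w j))"
      using nonneg_matrixD[OF A A0] Suc.prems w(1)
      by (intro mult_left_mono) (auto intro!: sum_norm_le simp: norm_mult)
    also have "\<dots> = (\<Sum>j<n. A $$ (i, j) * (spr A ^ k * norm (w j)))"
      by (simp add: sum_distrib_left mult_ac)
    also have "\<dots> \<le> (\<Sum>j<n. A $$ (i, j) * (c * pow_rowsum A k j))"
      using nonneg_matrixD[OF A A0] Suc by (intro sum_mono mult_left_mono) auto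
    also have "\<dots> = c * pow_rowsum A (Suc k) i"
      unfolding pow_rowsum_Suc[OF A Suc.prems] by (simp add: sum_distrib_left mult_ac)
    finally show ?case .
  qed
  have "norm (w i0) / c / (r - spr A) \<le> resolvent_rowsum A r i0" if r: "spr A < r" for r
  proof -
    have r0: "0 < r" using r spr_nonneg[OF A A0 n0] by simp
    have "(\<lambda>k. norm (w i0) / c / r * (spr A / r) ^ k) sums (norm (w i0) / c / r * (1 / (1 - spr A / r)))"
      using r r0 w(1) by (intro sums_mult geometric_sums) auto
    moreover have "norm (w i0) / c / r * (1 / (1 - spr A / r)) = norm (w i0) / c / (r - spr A)"
    proof -
      have "r * (1 - spr A / r) = r - spr A" using r0 by (simp add: right_diff_distrib)
      then show ?thesis by (metis divide_divide_eq_left mult.right_neutral times_divide_eq_right)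
    qed
    ultimately have s: "(\<lambda>k. norm (w i0) / c / r * (spr A / r) ^ k) sums (norm (w i0) / c / (r - spr A))"
      by (simp only:)
    have t: "(\<lambda>k. pow_rowsum A k i0 / r ^ Suc k) sums resolvent_rowsum A r i0"
      unfolding resolvent_rowsum_def by (rule summable_sums[OF resolvent_summable[OF A A0 n0 r w(2)]])
    show ?thesis
    proof (rule sums_le[OF _ s t])
      fix k
      have "spr A ^ k * norm (w i0) / c \<le> pow_rowsum A k i0"
        using pw[OF w(2), of k] c0 by (simp add: field_simps)
      then have "spr A ^ k * norm (w i0) / c / r ^ Suc k \<le> pow_rowsum A k i0 / r ^ Suc k"
        using r0 by (intro divide_right_mono) auto
      then show "norm (w i0) / c / r * (spr A / r) ^ k \<le> pow_rowsum A k i0 / r ^ Suc k"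
        by (simp add: power_divide mult_ac)
    qed
  qed
  moreover have "0 < norm (w i0) / c" using c0 w(3) by simp
  ultimately show ?thesis using w(2) by blast
qed

text \<open>Dividing r s = 1 + A s by the total t of s turns the constant 1 into 1 / t, which
  vanishes as r decreases to \<open>spr A\<close> because a component of s blows up. A limit point
  of the normalised s is an eigenvector, and total 1 keeps it nonzero.\<close>

lemma nonneg_eigenvector:
  obtains z :: "nat \<Rightarrow> real"
  where "\<And>i. i < n \<Longrightarrow> 0 \<le> z i" "(\<Sum>i<n. z i) = 1"
    "\<And>i. i < n \<Longrightarrow> (\<Sum>j<n. A $$ (i, j) * z j) = spr A * z i"
proof -
  obtain c i0 where c: "0 < c" "i0 < n"
    "\<And>r. spr A < r \<Longrightarrow> c / (r - spr A) \<le> resolvent_rowsum A r i0"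
    using resolvent_rowsum_blowup by blast
  define r where "r k = spr A + inverse (real (Suc k))" for k
  have r: "spr A < r k" for k unfolding r_def by simp
  define s where "s k = resolvent_rowsum A (r k)" for k
  define t where "t k = (\<Sum>i<n. s k i)" for k
  define f where "f k i = s k i / t k" for k i
  have s0: "0 < s k i" if "i < n" for k i
    unfolding s_def using resolvent_rowsum_pos(2)[OF A A0 n0 r that] .
  have st: "s k i \<le> t k" if "i < n" for k i
    unfolding t_def using that less_imp_le[OF s0] by (intro member_le_sum) auto
  have t0: "0 < t k" for k using s0[OF c(2), of k] st[OF c(2), of k] by linarith
  \<comment> \<open>Here \<open>r k - spr A\<close> is \<open>1 / (k + 1)\<close>, so the blow-up
    makes \<open>t k\<close> grow at least linearly.\<close>
  have t1: "inverse (t k) \<le> inverse c * inverse (real (Suc k))" for k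
  proof -
    have "c * real (Suc k) \<le> s k i0"
      using c(3)[OF r[of k]] unfolding s_def by (simp add: r_def divide_inverse)
    with st[OF c(2), of k] have "c * real (Suc k) \<le> t k" by linarith
    then have "inverse (t k) \<le> inverse (c * real (Suc k))"
      using c(1) by (intro le_imp_inverse_le) auto
    then show ?thesis by simp
  qed
  have tlim: "(\<lambda>k. inverse (t k)) \<longlonglongrightarrow> 0"
  proof (rule real_tendsto_sandwich[OF _ _ tendsto_const])
    show "(\<lambda>k. inverse c * inverse (real (Suc k))) \<longlonglongrightarrow> 0"
      by (rule tendsto_mult_right_zero[OF LIMSEQ_inverse_real_of_nat])
  qed (use t0 t1 in \<open>auto intro!: always_eventually simp: less_imp_le\<close>)
  have f: "0 \<le> f k i" "f k i \<le> 1" if "i < n" for k i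
    unfolding f_def using s0[OF that, of k] st[OF that, of k] t0[of k] by auto
  have "\<bar>f k i\<bar> \<le> 1" if "i < n" for k i using f[OF that, of k] by simp
  then obtain g l where g: "strict_mono (g :: nat \<Rightarrow> nat)"
    "\<And>i. i < n \<Longrightarrow> (\<lambda>k. f (g k) i) \<longlonglongrightarrow> l i"
    using bounded_family_convergent_subsequence[of n f 1] by blast
  have rlim: "(\<lambda>k. r (g k)) \<longlonglongrightarrow> spr A"
    using LIMSEQ_subseq_LIMSEQ[OF LIMSEQ_inverse_real_of_nat_add[of "spr A"] g(1)]
    by (simp add: o_def r_def)
  have tlim': "(\<lambda>k. inverse (t (g k))) \<longlonglongrightarrow> 0"
    using LIMSEQ_subseq_LIMSEQ[OF tlim g(1)] by (simp add: o_def)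
  show ?thesis
  proof (rule that)
    fix i assume i: "i < n"
    show "0 \<le> l i"
      by (rule LIMSEQ_le_const[OF g(2)[OF i]]) (use f(1)[OF i] in auto)
    have eq: "r k * f k i = inverse (t k) + (\<Sum>j<n. A $$ (i, j) * f k j)" for k
    proof -
      have "r k * s k i = 1 + (\<Sum>j<n. A $$ (i, j) * s k j)"
        unfolding s_def by (rule resolvent_rowsum_eq[OF A A0 n0 r i])
      then have "r k * s k i / t k = (1 + (\<Sum>j<n. A $$ (i, j) * s k j)) / t k" by simp
      then show ?thesis by (simp add: f_def add_divide_distrib sum_divide_distrib inverse_eq_divide)
    qed
    have "(\<lambda>k. r (g k) * f (g k) i) \<longlonglongrightarrow> spr A * l i"
      by (intro tendsto_mult rlim g(2) i)
    moreover have "(\<lambda>k. r (g k) * f (g k) i) \<longlonglongrightarrow> 0 + (\<Sum>j<n. A $$ (i, j) * l j)"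
      unfolding eq by (intro tendsto_add tendsto_sum tendsto_mult tendsto_const tlim' g(2)) auto
    ultimately show "(\<Sum>j<n. A $$ (i, j) * l j) = spr A * l i"
      using LIMSEQ_unique by fastforce
  next
    have "(\<Sum>i<n. f k i) = 1" for k
      unfolding f_def sum_divide_distrib[symmetric] using t0[of k] by (simp add: t_def)
    moreover have "(\<lambda>k. \<Sum>i<n. f (g k) i) \<longlonglongrightarrow> (\<Sum>i<n. l i)"
      by (intro tendsto_sum g(2)) auto
    ultimately show "(\<Sum>i<n. l i) = 1" by (simp add: LIMSEQ_const_iff)
  qed
qed

end

lemma spr_transpose:
  assumes "A \<in> carrier_mat n n"
  shows "spr (transpose_mat A) = spr A"
proof -
  let ?C = "map_mat complex_of_real A"
  have C: "?C \<in> carrier_mat n n" using assms by auto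
  have "map_mat complex_of_real (transpose_mat A) = transpose_mat ?C" by auto
  moreover have "spectrum (transpose_mat ?C) = spectrum ?C"
    using spectrum_root_char_poly[OF C] spectrum_root_char_poly[of "transpose_mat ?C" n]
      char_poly_transpose_mat[OF C] C by simp
  ultimately show ?thesis unfolding spr_def spectral_radius_def by simp
qed

text \<open>The transpose has the same spectral radius and supplies a nonnegative left eigenvector
  y. By y A^k = spr(A)^k y, positivity of y_i passes to y_j whenever entry (i, j) of A^k is
  positive, and irreducibility provides such a k for every j.\<close>

lemma irreducible_left_eigenvector:
  fixes A :: "real mat"
  assumes A: "A \<in> carrier_mat n n" and A0: "nonneg_matrix A"
    and n0: "0 < n" and irr: "irreducible_matrix A"
  obtains y :: "nat \<Rightarrow> real"
  where "\<And>i. i < n \<Longrightarrow> 0 < y i"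
    "\<And>j. j < n \<Longrightarrow> (\<Sum>i<n. y i * A $$ (i, j)) = spr A * y j"
proof -
  have T: "transpose_mat A \<in> carrier_mat n n" using A by auto
  have T0: "nonneg_matrix (transpose_mat A)"
    using nonneg_matrixD[OF A A0] A T by (simp add: nonneg_matrix_iff)
  obtain y where y: "\<And>i. i < n \<Longrightarrow> 0 \<le> y i" "(\<Sum>i<n. y i) = 1"
    "\<And>i. i < n \<Longrightarrow> (\<Sum>j<n. transpose_mat A $$ (i, j) * y j) = spr (transpose_mat A) * y i"
    using nonneg_eigenvector[OF T T0 n0] by blast
  have ev: "(\<Sum>i<n. y i * A $$ (i, j)) = spr A * y j" if "j < n" for j
    using y(3)[OF that] that A spr_transpose[OF A] by (simp add: mult_ac)
  have evk: "(\<Sum>i<n. y i * (A ^\<^sub>m k) $$ (i, j)) = spr A ^ k * y j" if "j < n" for j k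
    using that
  proof (induction k arbitrary: j)
    case 0
    have "(\<Sum>i<n. y i * (A ^\<^sub>m 0) $$ (i, j)) = (\<Sum>i<n. if i = j then y i else 0)"
      using 0 A by (intro sum.cong) auto
    then show ?case using 0 by simp
  next
    case (Suc k)
    have "(\<Sum>i<n. y i * (A ^\<^sub>m Suc k) $$ (i, j))
        = (\<Sum>i<n. \<Sum>l<n. y i * (A ^\<^sub>m k) $$ (i, l) * A $$ (l, j))"
      using pow_mat_Suc_entry[OF A _ Suc.prems]
      by (intro sum.cong) (auto simp: sum_distrib_left mult_ac simp del: pow_mat.simps)
    also have "\<dots> = (\<Sum>l<n. (\<Sum>i<n. y i * (A ^\<^sub>m k) $$ (i, l)) * A $$ (l, j))"
      unfolding sum_distrib_right by (rule sum.swap)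
    also have "\<dots> = (\<Sum>l<n. spr A ^ k * (y l * A $$ (l, j)))"
      using Suc.IH by (intro sum.cong) auto
    also have "\<dots> = spr A ^ k * (spr A * y j)"
      unfolding sum_distrib_left[symmetric] ev[OF Suc.prems] ..
    finally show ?case by simp
  qed
  have "\<exists>i<n. 0 < y i"
  proof (rule ccontr)
    assume "\<not> ?thesis"
    then have "(\<Sum>i<n. y i) \<le> 0" by (intro sum_nonpos) (meson lessThan_iff not_less)
    with y(2) show False by simp
  qed
  then obtain i where i: "i < n" "0 < y i" by auto
  have "0 < y j" if j: "j < n" for j
  proof -
    obtain k where k: "0 < (A ^\<^sub>m k) $$ (i, j)"
      using irr i(1) j A unfolding irreducible_matrix_def has_access_def by auto
    have "0 < y i * (A ^\<^sub>m k) $$ (i, j)" using k i by simp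
    also have "\<dots> \<le> (\<Sum>i<n. y i * (A ^\<^sub>m k) $$ (i, j))"
      using i j y(1) pow_mat_entry_nonneg[OF A A0] by (intro member_le_sum) auto
    also have "\<dots> = spr A ^ k * y j" by (rule evk[OF j])
    finally show ?thesis using y(1)[OF j] by (cases "y j = 0") auto
  qed
  with ev that show ?thesis by blast
qed

section \<open>Classes and depth\<close>

text \<open>\<open>pick D\<close> enumerates \<open>D\<close> increasingly, and counting the
  elements below inverts it. This translates between positions in a submatrix and states.\<close>

lemma bij_betw_pick:
  assumes "finite D"
  shows "bij_betw (pick D) {..<card D} D"
proof (rule bij_betw_byWitness[where f' = "\<lambda>i. card {a \<in> D. a < i}"])
  show "(\<lambda>i. card {a \<in> D. a < i}) ` D \<subseteq> {..<card D}"
    using assms by (auto intro!: psubset_card_mono)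
qed (auto simp: card_pick_le pick_in_set_le pick_card_in_set)

lemma submatrix_square:
  assumes "A \<in> carrier_mat n n" "D \<subseteq> {..<n}"
  shows "submatrix A D D \<in> carrier_mat (card D) (card D)"
    and "\<lbrakk>a < card D; b < card D\<rbrakk> \<Longrightarrow> submatrix A D D $$ (a, b) = A $$ (pick D a, pick D b)"
proof -
  have "{i. i < n \<and> i \<in> D} = D" using assms by auto
  then show "submatrix A D D \<in> carrier_mat (card D) (card D)"
    "\<lbrakk>a < card D; b < card D\<rbrakk> \<Longrightarrow> submatrix A D D $$ (a, b) = A $$ (pick D a, pick D b)"
    using assms unfolding submatrix_def by auto
qed

lemma nonneg_submatrix:
  assumes "A \<in> carrier_mat n n" "nonneg_matrix A" "D \<subseteq> {..<n}"
  shows "nonneg_matrix (submatrix A D D)"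
proof -
  have "pick D a < n" if "a < card D" for a
    using pick_in_set_le[OF that] assms(3) by auto
  then show ?thesis
    using submatrix_square[OF assms(1,3)] nonneg_matrixD[OF assms(1,2)]
    by (simp add: nonneg_matrix_iff)
qed

text \<open>The support digraph of \<open>A\<close> on \<open>D\<close>. Access is reachability in
  it, so the combinatorics of classes can proceed without matrix powers.\<close>

definition arcs :: "real mat \<Rightarrow> nat set \<Rightarrow> (nat \<times> nat) set" where
  "arcs A D = {(i, j). i \<in> D \<and> j \<in> D \<and> 0 < A $$ (i, j)}"

text \<open>An entry of a power is a sum of nonnegative products along walks, so it is positive
  exactly when some walk of that length uses positive entries only.\<close>

lemma has_access_iff:
  fixes A :: "real mat"
  assumes A: "A \<in> carrier_mat n n" and A0: "nonneg_matrix A"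
    and "i < n" "j < n"
  shows "has_access A i j \<longleftrightarrow> (i, j) \<in> (arcs A {..<n})\<^sup>*"
proof
  have "(i, j) \<in> (arcs A {..<n})\<^sup>*" if "0 < (A ^\<^sub>m k) $$ (i, j)" for k
    using that assms(3,4)
  proof (induction k arbitrary: j)
    case 0
    then show ?case using A by (auto split: if_splits)
  next
    case (Suc k)
    have "\<exists>l\<in>{..<n}. 0 < (A ^\<^sub>m k) $$ (i, l) * A $$ (l, j)"
    proof (rule ccontr)
      assume "\<not> ?thesis"
      then have "(\<Sum>l<n. (A ^\<^sub>m k) $$ (i, l) * A $$ (l, j)) \<le> 0"
        by (intro sum_nonpos) (auto simp: not_less)
      then show False using Suc.prems pow_mat_Suc_entry[OF A Suc.prems(2,3)] by simp
    qed
    then obtain l where l: "l < n" "0 < (A ^\<^sub>m k) $$ (i, l) * A $$ (l, j)" by auto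
    have "0 \<le> (A ^\<^sub>m k) $$ (i, l)" "0 \<le> A $$ (l, j)"
      using pow_mat_entry_nonneg[OF A A0] Suc.prems l(1) nonneg_matrixD[OF A A0] by auto
    with l(2) have "0 < (A ^\<^sub>m k) $$ (i, l)" "0 < A $$ (l, j)"
      by (auto simp: zero_less_mult_iff)
    then have "(i, l) \<in> (arcs A {..<n})\<^sup>*" "(l, j) \<in> arcs A {..<n}"
      using Suc l(1) unfolding arcs_def by auto
    then show ?case by (rule rtrancl_into_rtrancl)
  qed
  then show "has_access A i j \<Longrightarrow> (i, j) \<in> (arcs A {..<n})\<^sup>*"
    unfolding has_access_def by blast
  assume "(i, j) \<in> (arcs A {..<n})\<^sup>*"
  then show "has_access A i j"
  proof (induction rule: rtrancl_induct)
    case base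
    have "(A ^\<^sub>m 0) $$ (i, i) = 1" using A assms(3) by simp
    then show ?case unfolding has_access_def by (intro exI[of _ 0]) simp
  next
    case (step l m)
    then obtain k where k: "0 < (A ^\<^sub>m k) $$ (i, l)" unfolding has_access_def by auto
    have lm: "l < n" "m < n" "0 < A $$ (l, m)" using step(2) unfolding arcs_def by auto
    have "0 < (A ^\<^sub>m k) $$ (i, l) * A $$ (l, m)" using k lm by simp
    also have "\<dots> \<le> (\<Sum>l<n. (A ^\<^sub>m k) $$ (i, l) * A $$ (l, m))"
      using lm assms(3) by (intro member_le_sum) (auto intro!: mult_nonneg_nonneg nonneg_matrixD[OF A A0] pow_mat_entry_nonneg[OF A A0])
    also have "\<dots> = (A ^\<^sub>m Suc k) $$ (i, m)" using pow_mat_Suc_entry[OF A assms(3) lm(2)] by simp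
    finally show ?case unfolding has_access_def by blast
  qed
qed

lemma rtrancl_map:
  assumes "\<And>x y. (x, y) \<in> r \<Longrightarrow> (f x, f y) \<in> s" "(x, y) \<in> r\<^sup>*"
  shows "(f x, f y) \<in> s\<^sup>*"
  using assms(2) by induction (auto intro: rtrancl_into_rtrancl assms(1))

text \<open>Walks of the submatrix correspond to walks of \<open>A\<close> that stay inside
  \<open>D\<close>, hence \<open>arcs A D\<close> and not the full digraph. The renumberings
  \<open>pick D\<close> and \<open>g\<close> carry walks in both directions.\<close>

lemma irreducible_submatrix_iff:
  fixes A :: "real mat"
  assumes A: "A \<in> carrier_mat n n" and A0: "nonneg_matrix A"
    and D: "D \<subseteq> {..<n}"
  shows "irreducible_matrix (submatrix A D D) \<longleftrightarrow> (\<forall>i\<in>D. \<forall>j\<in>D. (i, j) \<in> (arcs A D)\<^sup>*)"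
proof -
  let ?m = "card D" and ?S = "submatrix A D D"
  define g where "g i = card {a \<in> D. a < i}" for i
  have fin: "finite D" using D finite_subset by blast
  note S = submatrix_square[OF A D]
  have p: "pick D a \<in> D" "g (pick D a) = a" if "a < ?m" for a
    using that unfolding g_def by (auto simp: card_pick_le pick_in_set_le)
  have g: "g i < ?m" "pick D (g i) = i" if "i \<in> D" for i
    using that fin unfolding g_def by (auto intro!: psubset_card_mono simp: pick_card_in_set)
  have S0: "nonneg_matrix ?S" by (rule nonneg_submatrix[OF A A0 D])
  have step: "(pick D a, pick D b) \<in> arcs A D" if "(a, b) \<in> arcs ?S {..<?m}" for a b
    using that p S(2) unfolding arcs_def by auto
  have step': "(g i, g j) \<in> arcs ?S {..<?m}" if "(i, j) \<in> arcs A D" for i j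
    using that g S(2) unfolding arcs_def by auto
  have eq: "(a, b) \<in> (arcs ?S {..<?m})\<^sup>* \<longleftrightarrow> (pick D a, pick D b) \<in> (arcs A D)\<^sup>*"
    if "a < ?m" "b < ?m" for a b
  proof
    show "(a, b) \<in> (arcs ?S {..<?m})\<^sup>* \<Longrightarrow> (pick D a, pick D b) \<in> (arcs A D)\<^sup>*"
      using step by (rule rtrancl_map)
    assume "(pick D a, pick D b) \<in> (arcs A D)\<^sup>*"
    with step' have "(g (pick D a), g (pick D b)) \<in> (arcs ?S {..<?m})\<^sup>*" by (rule rtrancl_map)
    then show "(a, b) \<in> (arcs ?S {..<?m})\<^sup>*" using p that by simp
  qed
  have "irreducible_matrix ?S \<longleftrightarrow> (\<forall>a<?m. \<forall>b<?m. (a, b) \<in> (arcs ?S {..<?m})\<^sup>*)"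
    unfolding irreducible_matrix_def using S(1) has_access_iff[OF S(1) S0] by auto
  also have "\<dots> \<longleftrightarrow> (\<forall>a<?m. \<forall>b<?m. (pick D a, pick D b) \<in> (arcs A D)\<^sup>*)"
    using eq by blast
  also have "\<dots> \<longleftrightarrow> (\<forall>i\<in>D. \<forall>j\<in>D. (i, j) \<in> (arcs A D)\<^sup>*)"
    using p g by metis
  finally show ?thesis .
qed

text \<open>The strongly connected component of \<open>i\<close>, empty if \<open>i\<close> is out
  of range. Naming a class by a representative turns depth into a function on states.\<close>

definition comm_class :: "real mat \<Rightarrow> nat \<Rightarrow> nat set" where
  "comm_class A i = {j. j < dim_row A \<and>
     (i, j) \<in> (arcs A {..<dim_row A})\<^sup>* \<and> (j, i) \<in> (arcs A {..<dim_row A})\<^sup>*}"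

lemma comm_class_eq:
  assumes "A \<in> carrier_mat n n"
  shows "comm_class A i = {j. j < n \<and> (i, j) \<in> (arcs A {..<n})\<^sup>* \<and> (j, i) \<in> (arcs A {..<n})\<^sup>*}"
  using assms unfolding comm_class_def by auto

text \<open>The contribution of one class to a chain length, kept as a number so that it can be
  added to a depth and serve as an exponent of \<open>e\<close>.\<close>

abbreviation class_basic :: "real mat \<Rightarrow> nat \<Rightarrow> nat" where
  "class_basic A i \<equiv> (if basic_class A (comm_class A i) then 1 else 0)"

abbreviation state_depth :: "real mat \<Rightarrow> nat \<Rightarrow> nat" where
  "state_depth A i \<equiv> class_depth A (comm_class A i)"

lemma class_chain_Cons:
  assumes "Cs \<noteq> []"
  shows "class_chain A (C # Cs) \<longleftrightarrow>
    is_class A C \<and> C \<notin> set Cs \<and> class_access A C (hd Cs) \<and> class_chain A Cs"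
proof -
  have "(\<forall>i. Suc i < length (C # Cs) \<longrightarrow> class_access A ((C # Cs) ! i) ((C # Cs) ! Suc i)) \<longleftrightarrow>
    class_access A C (hd Cs) \<and> (\<forall>i. Suc i < length Cs \<longrightarrow> class_access A (Cs ! i) (Cs ! Suc i))"
    (is "?l \<longleftrightarrow> ?r")
  proof
    assume l: ?l
    show ?r using l[rule_format, of 0] l[rule_format, of "Suc _"] assms
      by (auto simp: hd_conv_nth)
  next
    assume r: ?r
    show ?l
    proof (intro allI impI)
      fix i assume "Suc i < length (C # Cs)"
      then show "class_access A ((C # Cs) ! i) ((C # Cs) ! Suc i)"
        using r assms by (cases i) (auto simp: hd_conv_nth)
    qed
  qed
  then show ?thesis unfolding class_chain_def using assms by auto
qed

lemma class_chain_single: "class_chain A [C] \<longleftrightarrow> is_class A C"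
  unfolding class_chain_def by auto

lemma chain_length_Cons:
  "chain_length A (C # Cs) = (if basic_class A C then 1 else 0) + chain_length A Cs"
  unfolding chain_length_def by auto

context
  fixes A :: "real mat" and n :: nat
  assumes A: "A \<in> carrier_mat n n" and A0: "nonneg_matrix A"
begin

text \<open>A walk between two states of a class never leaves it: every state on the way is
  accessible from the class and has access back to it.\<close>

lemma comm_class_connected:
  assumes "k \<in> comm_class A i" "l \<in> comm_class A i"
  shows "(k, l) \<in> (arcs A (comm_class A i))\<^sup>*"
proof -
  have "(k, l) \<in> (arcs A {..<n})\<^sup>*" using assms unfolding comm_class_eq[OF A]
    by (auto intro: rtrancl_trans)
  then show ?thesis using assms(1)
  proof (induction rule: converse_rtrancl_induct)
    case (step a b)
    have ab: "a < n" "b < n" "(a, b) \<in> (arcs A {..<n})\<^sup>*" using step(1) unfolding arcs_def by auto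
    have "b \<in> comm_class A i"
      using ab step.prems step.hyps(2) assms(2) unfolding comm_class_eq[OF A]
      by (auto intro: rtrancl_trans)
    with step show ?case
      by (intro converse_rtrancl_into_rtrancl[of a b]) (auto simp: arcs_def)
  qed simp
qed

lemma connected_subset_comm_class:
  assumes "D \<subseteq> {..<n}" "\<forall>i\<in>D. \<forall>j\<in>D. (i, j) \<in> (arcs A D)\<^sup>*" "i \<in> D"
  shows "D \<subseteq> comm_class A i"
proof -
  have "arcs A D \<subseteq> arcs A {..<n}" using assms(1) unfolding arcs_def by auto
  then have "(arcs A D)\<^sup>* \<subseteq> (arcs A {..<n})\<^sup>*" by (rule rtrancl_mono)
  then show ?thesis using assms unfolding comm_class_eq[OF A] by blast
qed

lemma comm_class_subset: "comm_class A i \<subseteq> {..<n}"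
  unfolding comm_class_eq[OF A] by auto

lemma comm_class_self: "i < n \<Longrightarrow> i \<in> comm_class A i"
  unfolding comm_class_eq[OF A] by auto

lemma comm_class_cong: "j \<in> comm_class A i \<Longrightarrow> comm_class A j = comm_class A i"
  unfolding comm_class_eq[OF A] by (auto intro: rtrancl_trans)

lemma irreducible_comm_class: "irreducible_matrix (submatrix A (comm_class A i) (comm_class A i))"
  using comm_class_connected irreducible_submatrix_iff[OF A A0 comm_class_subset] by blast

text \<open>Maximality leaves only whole strongly connected components. For \<open>n = 0\<close> the
  empty set satisfies \<open>is_class\<close>; for positive \<open>n\<close> it is irreducible but
  not maximal.\<close>

lemma is_class_iff:
  assumes "0 < n"
  shows "is_class A C \<longleftrightarrow> (\<exists>i<n. C = comm_class A i)"
proof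
  assume C: "is_class A C"
  then have sub: "C \<subseteq> {..<n}" and irr: "irreducible_matrix (submatrix A C C)"
    and max: "\<And>D. C \<subset> D \<Longrightarrow> D \<subseteq> {..<n} \<Longrightarrow> \<not> irreducible_matrix (submatrix A D D)"
    unfolding is_class_def using A by auto
  have conn: "\<forall>i\<in>C. \<forall>j\<in>C. (i, j) \<in> (arcs A C)\<^sup>*"
    using irr irreducible_submatrix_iff[OF A A0 sub] by blast
  have "C \<noteq> {}"
    using max[OF _ comm_class_subset] irreducible_comm_class comm_class_self[OF assms] by blast
  then obtain i where i: "i \<in> C" by auto
  then have "C \<subseteq> comm_class A i" using connected_subset_comm_class[OF sub conn] by auto
  moreover have "\<not> C \<subset> comm_class A i" using max comm_class_subset irreducible_comm_class by blast
  ultimately show "\<exists>i<n. C = comm_class A i" using i sub by auto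
next
  assume "\<exists>i<n. C = comm_class A i"
  then obtain i where i: "i < n" "C = comm_class A i" by auto
  have "\<not> irreducible_matrix (submatrix A D D)" if D: "C \<subset> D" "D \<subseteq> {..<n}" for D
  proof
    assume "irreducible_matrix (submatrix A D D)"
    then have "D \<subseteq> comm_class A i"
      using irreducible_submatrix_iff[OF A A0 D(2)] connected_subset_comm_class[OF D(2), of i]
        comm_class_self i D by blast
    then show False using D i by auto
  qed
  then show "is_class A C" unfolding is_class_def
    using A i irreducible_comm_class comm_class_subset by auto
qed

lemma is_class_comm_class: "i < n \<Longrightarrow> is_class A (comm_class A i)"
  using is_class_iff by (cases n) auto

lemma class_access_iff:
  assumes "i < n" "j < n"
  shows "class_access A (comm_class A i) (comm_class A j) \<longleftrightarrow> (i, j) \<in> (arcs A {..<n})\<^sup>*"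
proof
  assume "class_access A (comm_class A i) (comm_class A j)"
  then obtain k l where kl: "k \<in> comm_class A i" "l \<in> comm_class A j" "has_access A k l"
    unfolding class_access_def by auto
  then have "(k, l) \<in> (arcs A {..<n})\<^sup>*"
    using has_access_iff[OF A A0] comm_class_subset by blast
  with kl show "(i, j) \<in> (arcs A {..<n})\<^sup>*"
    unfolding comm_class_eq[OF A] by (auto intro: rtrancl_trans)
next
  assume "(i, j) \<in> (arcs A {..<n})\<^sup>*"
  then show "class_access A (comm_class A i) (comm_class A j)"
    unfolding class_access_def using has_access_iff[OF A A0] comm_class_self assms by blast
qed

text \<open>Transitivity of access along the chain. It shows below that a class without access from
  the head of a chain does not occur in that chain.\<close>

lemma class_chain_access:
  assumes "class_chain A Cs" "C \<in> set Cs" "hd Cs = comm_class A i" "C = comm_class A j" "i < n" "j < n"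
  shows "(i, j) \<in> (arcs A {..<n})\<^sup>*"
  using assms
proof (induction Cs arbitrary: i)
  case (Cons D Ds)
  show ?case
  proof (cases "C = D")
    case True
    then show ?thesis using Cons.prems comm_class_self[of j] unfolding comm_class_eq[OF A] by auto
  next
    case False
    then have C: "C \<in> set Ds" "Ds \<noteq> []" using Cons.prems by auto
    then have ch: "class_access A D (hd Ds)" "class_chain A Ds"
      using Cons.prems(1) class_chain_Cons by auto
    have "is_class A (hd Ds)" using ch C unfolding class_chain_def by auto
    then obtain k where k: "k < n" "hd Ds = comm_class A k"
      using is_class_iff Cons.prems(5) by (metis less_nat_zero_code not_gr_zero)
    have "(i, k) \<in> (arcs A {..<n})\<^sup>*"
      using ch k Cons.prems class_access_iff by auto
    moreover have "(k, j) \<in> (arcs A {..<n})\<^sup>*"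
      using Cons.IH[OF ch(2) C(1) k(2)] k Cons.prems by auto
    ultimately show ?thesis by (rule rtrancl_trans)
  qed
qed simp

text \<open>The members of a chain are distinct subsets of a finite set, which bounds its length.
  The maxima that define depth and degree are thereby genuine.\<close>

lemma finite_class_chains: "finite {Cs. class_chain A Cs}"
proof (rule finite_subset)
  show "{Cs. class_chain A Cs} \<subseteq> {Cs. set Cs \<subseteq> Pow {..<n} \<and> length Cs \<le> card (Pow {..<n})}"
  proof safe
    fix Cs C i assume "class_chain A Cs" "C \<in> set Cs" "i \<in> C"
    then show "i < n" unfolding class_chain_def is_class_def using A by auto
  next
    fix Cs assume Cs: "class_chain A Cs"
    then have "set Cs \<subseteq> Pow {..<n}" unfolding class_chain_def is_class_def using A by auto
    then have "card (set Cs) \<le> card (Pow {..<n})" by (intro card_mono) auto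
    then show "length Cs \<le> card (Pow {..<n})"
      using Cs distinct_card[of Cs] unfolding class_chain_def by auto
  qed
  show "finite {Cs. set Cs \<subseteq> Pow {..<n} \<and> length Cs \<le> card (Pow {..<n})}"
    by (rule finite_lists_length_le) simp
qed

lemma finite_chain_lengths:
  "finite {chain_length A Cs |Cs. class_chain A Cs \<and> hd Cs = C}"
  "finite {chain_length A Cs |Cs. class_chain A Cs}"
  using finite_class_chains by (auto intro: finite_subset[of _ "chain_length A ` {Cs. class_chain A Cs}"])

lemma chain_length_le_depth:
  "class_chain A Cs \<Longrightarrow> chain_length A Cs \<le> class_depth A (hd Cs)"
  unfolding class_depth_def by (rule Max_ge[OF finite_chain_lengths(1)]) auto

lemma class_depth_attained:
  assumes "is_class A C"
  obtains Cs where "class_chain A Cs" "hd Cs = C" "chain_length A Cs = class_depth A C"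
proof -
  have "class_chain A [C]" using assms class_chain_single by auto
  then have "chain_length A [C] \<in> {chain_length A Cs |Cs. class_chain A Cs \<and> hd Cs = C}"
    by (metis (mono_tags, lifting) list.sel(1) mem_Collect_eq)
  then have "class_depth A C \<in> {chain_length A Cs |Cs. class_chain A Cs \<and> hd Cs = C}"
    unfolding class_depth_def by (intro Max_in finite_chain_lengths) auto
  then show ?thesis using that by auto
qed

lemma state_depth_le_degree:
  assumes "i < n" shows "state_depth A i \<le> degree_mat A"
proof -
  obtain Cs where Cs: "class_chain A Cs" "chain_length A Cs = state_depth A i"
    using class_depth_attained[OF is_class_comm_class[OF assms]] by metis
  have "chain_length A Cs \<le> degree_mat A" unfolding degree_mat_def
    by (rule Max_ge[OF finite_chain_lengths(2)]) (use Cs(1) in blast)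
  with Cs(2) show ?thesis by simp
qed

text \<open>The class of \<open>i\<close> can be put in front of a longest chain from the class of
  \<open>j\<close>: it is not repeated there, since otherwise \<open>j\<close> would have access to
  \<open>i\<close>.\<close>

lemma state_depth_access:
  assumes "i < n" "j < n" "(i, j) \<in> (arcs A {..<n})\<^sup>*" "(j, i) \<notin> (arcs A {..<n})\<^sup>*"
  shows "class_basic A i + state_depth A j \<le> state_depth A i"
proof -
  obtain Cs where Cs: "class_chain A Cs" "hd Cs = comm_class A j" "chain_length A Cs = state_depth A j"
    using class_depth_attained[OF is_class_comm_class[OF assms(2)]] by metis
  have "comm_class A i \<notin> set Cs"
    using class_chain_access[OF Cs(1) _ Cs(2) _ assms(2,1)] assms(4) by blast
  moreover have "Cs \<noteq> []" using Cs(1) unfolding class_chain_def by auto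
  ultimately have "class_chain A (comm_class A i # Cs)"
    using Cs class_chain_Cons is_class_comm_class[OF assms(1)] class_access_iff[OF assms(1,2)] assms(3)
    by auto
  from chain_length_le_depth[OF this] show ?thesis by (simp add: chain_length_Cons Cs(3))
qed

text \<open>Removing the head of a longest chain leaves nothing or a longest chain from a strict
  successor. With \<open>state_depth_access\<close> this is a recursion for depth along one-way
  access, the form in which depth enters the growth estimates.\<close>

lemma state_depth_cases:
  assumes "i < n"
  obtains "state_depth A i = class_basic A i"
  | j where "j < n" "(i, j) \<in> (arcs A {..<n})\<^sup>*" "(j, i) \<notin> (arcs A {..<n})\<^sup>*"
      "state_depth A i = class_basic A i + state_depth A j"
proof -
  obtain Cs where Cs: "class_chain A Cs" "hd Cs = comm_class A i" "chain_length A Cs = state_depth A i"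
    using class_depth_attained[OF is_class_comm_class[OF assms]] by metis
  then obtain Ds where Ds: "Cs = comm_class A i # Ds" unfolding class_chain_def by (cases Cs) auto
  show ?thesis
  proof (cases "Ds = []")
    case True
    then show ?thesis using that(1) Cs(3) Ds by (simp add: chain_length_def split: if_splits)
  next
    case False
    with Cs Ds have ch: "comm_class A i \<notin> set Ds" "class_access A (comm_class A i) (hd Ds)" "class_chain A Ds"
      using class_chain_Cons by auto
    have "is_class A (hd Ds)" using ch False unfolding class_chain_def by auto
    then obtain j where j: "j < n" "hd Ds = comm_class A j"
      using is_class_iff assms by (metis less_nat_zero_code not_gr_zero)
    have ij: "(i, j) \<in> (arcs A {..<n})\<^sup>*" using ch j class_access_iff assms by auto
    have ji: "(j, i) \<notin> (arcs A {..<n})\<^sup>*"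
    proof
      assume "(j, i) \<in> (arcs A {..<n})\<^sup>*"
      then have "j \<in> comm_class A i" using ij j unfolding comm_class_eq[OF A] by auto
      then have "hd Ds = comm_class A i" using comm_class_cong j by auto
      then show False using ch(1) False by (metis hd_in_set)
    qed
    have "state_depth A i \<le> class_basic A i + state_depth A j"
      using chain_length_le_depth[OF ch(3)] Cs(3) Ds j by (simp add: chain_length_Cons)
    with state_depth_access[OF assms j(1) ij ji] show ?thesis using that(2)[OF j(1) ij ji] by simp
  qed
qed

lemma principal_part_eq: "principal_part A k = {i. i < n \<and> state_depth A i = k}"
\<comment> \<open>For \<open>n = 0\<close> the only class is the empty set, outside the scope of
  \<open>is_class_iff\<close>; both sides are empty then.\<close>
proof (cases "n = 0")
  case True
  then show ?thesis unfolding principal_part_def is_class_def using A by auto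
next
  case False
  show ?thesis
  proof (rule Set.set_eqI, rule iffI)
    fix i assume "i \<in> principal_part A k"
    then obtain j where j: "j < n" "i \<in> comm_class A j" "class_depth A (comm_class A j) = k"
      unfolding principal_part_def using is_class_iff False by auto
    then show "i \<in> {i. i < n \<and> state_depth A i = k}"
      using comm_class_cong[OF j(2)] subsetD[OF comm_class_subset j(2)] by auto
  next
    fix i assume "i \<in> {i. i < n \<and> state_depth A i = k}"
    then show "i \<in> principal_part A k"
      unfolding principal_part_def using comm_class_self is_class_comm_class by auto
  qed
qed

end

section \<open>Growth of the resolvent at the spectral radius\<close>

lemma rtrancl_exit:
  assumes "(i, j) \<in> r\<^sup>*" "i \<in> C" "j \<notin> C"
  obtains k l where "k \<in> C" "l \<notin> C" "(k, l) \<in> r" "(l, j) \<in> r\<^sup>*"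
proof -
  from assms(1,2) have "\<exists>k l. k \<in> C \<and> l \<notin> C \<and> (k, l) \<in> r \<and> (l, j) \<in> r\<^sup>*"
  proof (induction rule: converse_rtrancl_induct)
    case base
    then show ?case using assms(3) by blast
  next
    case (step a b)
    then show ?case by (cases "b \<in> C") blast+
  qed
  with that show thesis by blast
qed

section \<open>Balance of the resolvent over a class\<close>

context
  fixes A :: "real mat" and n :: nat
  assumes A: "A \<in> carrier_mat n n" and A0: "nonneg_matrix A"
    and n0: "0 < n"
begin

text \<open>The Perron vector of the class submatrix, carried back from positions to states.\<close>

lemma class_left_eigenvector:
  assumes i: "i < n"
  defines "C \<equiv> comm_class A i"
  obtains y where "\<And>k. k \<in> C \<Longrightarrow> 0 < y k"
    "\<And>j. j \<in> C \<Longrightarrow> (\<Sum>k\<in>C. y k * A $$ (k, j)) = spr (submatrix A C C) * y j"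
proof -
  let ?S = "submatrix A C C"
  have C: "C \<subseteq> {..<n}" unfolding C_def by (rule comm_class_subset[OF A A0])
  have fin: "finite C" using C finite_subset by blast
  have iC: "i \<in> C" unfolding C_def by (rule comm_class_self[OF A A0 i])
  note S = submatrix_square[OF A C]
  have m0: "0 < card C" using fin iC card_gt_0_iff by blast
  have S0: "nonneg_matrix ?S" by (rule nonneg_submatrix[OF A A0 C])
  have irr: "irreducible_matrix ?S" unfolding C_def by (rule irreducible_comm_class[OF A A0])
  obtain y where y: "\<And>a. a < card C \<Longrightarrow> 0 < y a"
    "\<And>b. b < card C \<Longrightarrow> (\<Sum>a<card C. y a * ?S $$ (a, b)) = spr ?S * y b"
    using irreducible_left_eigenvector[OF S(1) S0 m0 irr] by blast
  define g where "g k = card {a \<in> C. a < k}" for k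
  have g: "g k < card C" "pick C (g k) = k" if "k \<in> C" for k
    using that fin unfolding g_def by (auto intro!: psubset_card_mono simp: pick_card_in_set)
  have gp: "g (pick C a) = a" if "a < card C" for a
    using that unfolding g_def by (simp add: card_pick_le)
  show thesis
  proof (rule that[of "y \<circ> g"])
    fix k assume "k \<in> C" then show "0 < (y \<circ> g) k" using y(1) g by simp
  next
    fix j assume j: "j \<in> C"
    have "(\<Sum>k\<in>C. (y \<circ> g) k * A $$ (k, j)) = (\<Sum>a<card C. (y \<circ> g) (pick C a) * A $$ (pick C a, j))"
      by (rule sum.reindex_bij_betw[OF bij_betw_pick[OF fin], symmetric])
    also have "\<dots> = (\<Sum>a<card C. y a * ?S $$ (a, g j))"
      using gp S(2) g[OF j] by (intro sum.cong) auto
    also have "\<dots> = spr ?S * (y \<circ> g) j" using y(2) g[OF j] by simp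
    finally show "(\<Sum>k\<in>C. (y \<circ> g) k * A $$ (k, j)) = spr ?S * (y \<circ> g) j" .
  qed
qed

text \<open>The terms with both indices in \<open>C\<close> collapse to the factor \<open>m\<close>
  by the left eigenvector equation; the right-hand side is the source fed by the constant 1 and by
  the states outside \<open>C\<close>. At \<open>r = spr A + e\<close> the factor
  \<open>r - m\<close> equals \<open>e\<close> for a basic class and stays away from 0 for any
  other, so exactly the basic classes gain a factor 1 / e.\<close>

lemma class_resolvent_identity:
  assumes C: "C \<subseteq> {..<n}" and r: "spr A < r"
    and y: "\<And>j. j \<in> C \<Longrightarrow> (\<Sum>k\<in>C. y k * A $$ (k, j)) = m * y j"
  shows "(r - m) * (\<Sum>k\<in>C. y k * resolvent_rowsum A r k) =
    (\<Sum>k\<in>C. y k * (1 + (\<Sum>l\<in>{..<n} - C. A $$ (k, l) * resolvent_rowsum A r l)))"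
proof -
  let ?s = "resolvent_rowsum A r"
  have "r * (\<Sum>k\<in>C. y k * ?s k) = (\<Sum>k\<in>C. y k * (r * ?s k))"
    by (simp add: sum_distrib_left mult_ac)
  also have "\<dots> = (\<Sum>k\<in>C. y k * (1 + (\<Sum>l\<in>{..<n} - C. A $$ (k, l) * ?s l))
      + (\<Sum>l\<in>C. y k * A $$ (k, l) * ?s l))"
  proof (rule sum.cong[OF refl])
    fix k assume "k \<in> C"
    then have k: "k < n" using C by auto
    have "r * ?s k = 1 + (\<Sum>l<n. A $$ (k, l) * ?s l)"
      by (rule resolvent_rowsum_eq[OF A A0 n0 r k])
    also have "(\<Sum>l<n. A $$ (k, l) * ?s l)
        = (\<Sum>l\<in>{..<n} - C. A $$ (k, l) * ?s l) + (\<Sum>l\<in>C. A $$ (k, l) * ?s l)"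
      by (rule sum.subset_diff[OF C]) simp
    finally show "y k * (r * ?s k) = y k * (1 + (\<Sum>l\<in>{..<n} - C. A $$ (k, l) * ?s l))
      + (\<Sum>l\<in>C. y k * A $$ (k, l) * ?s l)"
      by (simp add: algebra_simps sum_distrib_left)
  qed
  also have "\<dots> = (\<Sum>k\<in>C. y k * (1 + (\<Sum>l\<in>{..<n} - C. A $$ (k, l) * ?s l)))
      + (\<Sum>k\<in>C. \<Sum>l\<in>C. y k * A $$ (k, l) * ?s l)"
    by (rule sum.distrib)
  also have "(\<Sum>k\<in>C. \<Sum>l\<in>C. y k * A $$ (k, l) * ?s l) = (\<Sum>l\<in>C. (\<Sum>k\<in>C. y k * A $$ (k, l)) * ?s l)"
    unfolding sum_distrib_right by (rule sum.swap)
  also have "\<dots> = m * (\<Sum>l\<in>C. y l * ?s l)"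
    using y by (simp add: sum_distrib_left mult_ac)
  finally show ?thesis by (simp add: algebra_simps)
qed

text \<open>All summands of the source are nonnegative, so each single one is a lower bound: the
  constant 1 at \<open>k\<close>, or one arc leaving \<open>C\<close>.\<close>

lemma class_source_ge:
  assumes C: "C \<subseteq> {..<n}" and r: "spr A < r" and y: "\<And>k. k \<in> C \<Longrightarrow> 0 < y k" and k: "k \<in> C"
  shows "y k \<le> (\<Sum>k\<in>C. y k * (1 + (\<Sum>l\<in>{..<n} - C. A $$ (k, l) * resolvent_rowsum A r l)))"
    and "l \<in> {..<n} - C \<Longrightarrow> y k * (A $$ (k, l) * resolvent_rowsum A r l)
      \<le> (\<Sum>k\<in>C. y k * (1 + (\<Sum>l\<in>{..<n} - C. A $$ (k, l) * resolvent_rowsum A r l)))"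
proof -
  let ?s = "resolvent_rowsum A r"
  let ?g = "\<lambda>k. \<Sum>l\<in>{..<n} - C. A $$ (k, l) * ?s l"
  have s0: "0 \<le> ?s i" if "i < n" for i using resolvent_rowsum_pos(2)[OF A A0 n0 r that] by simp
  have g0: "0 \<le> ?g k" if "k \<in> C" for k
    using that C nonneg_matrixD[OF A A0] s0 by (auto intro!: sum_nonneg mult_nonneg_nonneg)
  have fin: "finite C" using C finite_subset by blast
  have *: "y k * (1 + ?g k) \<le> (\<Sum>k\<in>C. y k * (1 + ?g k))"
    using fin k g0 less_imp_le[OF y] by (intro member_le_sum) auto
  have "y k * 1 \<le> y k * (1 + ?g k)" using g0[OF k] less_imp_le[OF y[OF k]] by (intro mult_left_mono) auto
  with * show "y k \<le> (\<Sum>k\<in>C. y k * (1 + ?g k))" by simp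
  assume l: "l \<in> {..<n} - C"
  have "A $$ (k, l) * ?s l \<le> ?g k"
    using l k C nonneg_matrixD[OF A A0] s0 by (intro member_le_sum) (auto intro!: mult_nonneg_nonneg)
  then have "y k * (A $$ (k, l) * ?s l) \<le> y k * (1 + ?g k)"
    using less_imp_le[OF y[OF k]] by (intro mult_left_mono) auto
  with * show "y k * (A $$ (k, l) * ?s l) \<le> (\<Sum>k\<in>C. y k * (1 + ?g k))" by simp
qed

text \<open>If the class had the larger spectral radius, the balance could be taken at
  \<open>r\<close> equal to it: its left-hand side would vanish while the source is at least
  \<open>y i > 0\<close>.\<close>

lemma spr_class_le:
  assumes i: "i < n"
  shows "spr (submatrix A (comm_class A i) (comm_class A i)) \<le> spr A"
proof (rule ccontr)
  let ?C = "comm_class A i"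
  let ?m = "spr (submatrix A ?C ?C)"
  assume "\<not> ?thesis"
  then have m: "spr A < ?m" by simp
  have C: "?C \<subseteq> {..<n}" by (rule comm_class_subset[OF A A0])
  have iC: "i \<in> ?C" by (rule comm_class_self[OF A A0 i])
  obtain y where y: "\<And>k. k \<in> ?C \<Longrightarrow> 0 < y k"
    "\<And>j. j \<in> ?C \<Longrightarrow> (\<Sum>k\<in>?C. y k * A $$ (k, j)) = ?m * y j"
    using class_left_eigenvector[OF i] by blast
  show False
    using class_resolvent_identity[OF C m y(2)] class_source_ge(1)[where y = y and k = i, OF C m y(1) iC]
      y(1)[OF iC] by simp
qed

text \<open>An arc from i to k gives (spr A + e) s_i >= A_ik s_k, and \<open>e <= 1\<close> bounds
  the factor on the left. The constant is therefore uniform in \<open>e\<close>.\<close>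

lemma resolvent_access:
  assumes "(i, j) \<in> (arcs A {..<n})\<^sup>*"
  shows "\<exists>c>0. \<forall>e>0. e \<le> 1 \<longrightarrow> c * resolvent_rowsum A (spr A + e) j \<le> resolvent_rowsum A (spr A + e) i"
  using assms
proof (induction rule: converse_rtrancl_induct)
  case base
  show ?case by (intro exI[of _ 1]) simp
next
  case (step i k)
  let ?s = "\<lambda>e. resolvent_rowsum A (spr A + e)"
  have ik: "i < n" "k < n" "0 < A $$ (i, k)" using step(1) unfolding arcs_def by auto
  obtain c where c: "0 < c" "\<And>e. 0 < e \<Longrightarrow> e \<le> 1 \<Longrightarrow> c * ?s e j \<le> ?s e k"
    using step.IH by blast
  have l0: "0 \<le> spr A" by (rule spr_nonneg[OF A A0 n0])
  have "A $$ (i, k) / (spr A + 1) * c * ?s e j \<le> ?s e i" if e: "0 < e" "e \<le> 1" for e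
  proof -
    have r: "spr A < spr A + e" using e by simp
    have pos: "0 < ?s e l" if "l < n" for l using resolvent_rowsum_pos(2)[OF A A0 n0 r that] .
    have "A $$ (i, k) * (c * ?s e j) \<le> A $$ (i, k) * ?s e k"
      using c(2)[OF e] ik by (intro mult_left_mono) auto
    also have "\<dots> \<le> (\<Sum>l<n. A $$ (i, l) * ?s e l)"
      using ik nonneg_matrixD[OF A A0] less_imp_le[OF pos] by (intro member_le_sum) (auto intro!: mult_nonneg_nonneg)
    also have "\<dots> \<le> (spr A + e) * ?s e i" using resolvent_rowsum_eq[OF A A0 n0 r ik(1)] by simp
    also have "\<dots> \<le> (spr A + 1) * ?s e i" using e pos[OF ik(1)] by (intro mult_right_mono) auto
    finally show ?thesis using l0 by (simp add: field_simps)
  qed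
  moreover have "0 < A $$ (i, k) / (spr A + 1) * c" using ik l0 c(1) by simp
  ultimately show ?case by blast
qed

lemma class_basic_le_depth: "i < n \<Longrightarrow> class_basic A i \<le> state_depth A i"
  by (rule state_depth_cases[OF A A0, of i]) auto

text \<open>The measure for the inductions on growth: one-way access loses at least the state
  \<open>i\<close> itself.\<close>

lemma card_reachable_less:
  assumes "i < n" "(i, j) \<in> (arcs A {..<n})\<^sup>*" "(j, i) \<notin> (arcs A {..<n})\<^sup>*"
  shows "card {k. k < n \<and> (j, k) \<in> (arcs A {..<n})\<^sup>*} < card {k. k < n \<and> (i, k) \<in> (arcs A {..<n})\<^sup>*}"
  using assms by (intro psubset_card_mono) (auto intro: rtrancl_trans)

text \<open>A state inherits the rate of a strict successor that realises its depth, and its own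
  class contributes one more factor 1 / e if it is basic.\<close>

lemma resolvent_lower:
  assumes "i < n"
  shows "\<exists>c>0. \<forall>e>0. e \<le> 1 \<longrightarrow> c / e ^ state_depth A i \<le> resolvent_rowsum A (spr A + e) i"
  using assms
proof (induction "card {k. k < n \<and> (i, k) \<in> (arcs A {..<n})\<^sup>*}" arbitrary: i rule: less_induct)
  case less
  note i = less.prems
  let ?R = "(arcs A {..<n})\<^sup>*"
  let ?s = "\<lambda>e. resolvent_rowsum A (spr A + e)"
  let ?C = "comm_class A i"
  have C: "?C \<subseteq> {..<n}" by (rule comm_class_subset[OF A A0])
  have iC: "i \<in> ?C" by (rule comm_class_self[OF A A0 i])
  have fin: "finite ?C" using C finite_subset by blast
  have l0: "0 \<le> spr A" by (rule spr_nonneg[OF A A0 n0])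
  have pos: "0 < ?s e l" if "0 < e" "l < n" for e l
    using resolvent_rowsum_pos(2)[OF A A0 n0 _ that(2)] that(1) by simp
  have one: "1 / (spr A + 1) \<le> ?s e i" if "0 < e" "e \<le> 1" for e
  proof -
    have "1 / (spr A + 1) \<le> 1 / (spr A + e)" using that l0 by (intro divide_left_mono) auto
    also have "\<dots> \<le> ?s e i" using resolvent_rowsum_pos(1)[OF A A0 n0 _ i] that by simp
    finally show ?thesis .
  qed
  have IH: "\<exists>c>0. \<forall>e>0. e \<le> 1 \<longrightarrow> c / e ^ state_depth A j \<le> ?s e j"
    if "j < n" "(i, j) \<in> ?R" "(j, i) \<notin> ?R" for j
    using less.hyps[OF card_reachable_less[OF i that(2,3)] that(1)] .
  obtain y where y: "\<And>k. k \<in> ?C \<Longrightarrow> 0 < y k"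
    "\<And>j. j \<in> ?C \<Longrightarrow> (\<Sum>k\<in>?C. y k * A $$ (k, j)) = spr (submatrix A ?C ?C) * y j"
    using class_left_eigenvector[OF i] by blast
  \<comment> \<open>Within a class all components are comparable, uniformly in \<open>e\<close>;
    \<open>Y\<close> then bounds the weighted sum over the class by a multiple of the component at
    \<open>i\<close>.\<close>
  have "\<exists>a. \<forall>k\<in>?C. 0 < a k \<and> (\<forall>e>0. e \<le> 1 \<longrightarrow> a k * ?s e k \<le> ?s e i)"
  proof (rule bchoice, rule ballI)
    fix k assume "k \<in> ?C"
    then have "(i, k) \<in> ?R" unfolding comm_class_eq[OF A] by auto
    from resolvent_access[OF this]
    show "\<exists>c. 0 < c \<and> (\<forall>e>0. e \<le> 1 \<longrightarrow> c * ?s e k \<le> ?s e i)" by blast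
  qed
  then obtain a where a: "\<And>k. k \<in> ?C \<Longrightarrow> 0 < a k"
    "\<And>k e. k \<in> ?C \<Longrightarrow> 0 < e \<Longrightarrow> e \<le> 1 \<Longrightarrow> a k * ?s e k \<le> ?s e i" by blast
  define Y where "Y = (\<Sum>k\<in>?C. y k / a k)"
  have Y0: "0 < Y" unfolding Y_def using iC y(1) a(1) fin by (intro sum_pos) auto
  let ?src = "\<lambda>e. \<Sum>k\<in>?C. y k * (1 + (\<Sum>l\<in>{..<n} - ?C. A $$ (k, l) * ?s e l))"
  \<comment> \<open>The gain of a basic class: the left-hand factor of the balance is
    \<open>e\<close> itself, so a source of order e^(-m) forces order e^(-m-1).\<close>
  have basic: "\<exists>c>0. \<forall>e>0. e \<le> 1 \<longrightarrow> c / e ^ Suc m \<le> ?s e i"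
    if b: "basic_class A ?C" and dl: "0 < dl" "\<And>e. 0 < e \<Longrightarrow> e \<le> 1 \<Longrightarrow> dl / e ^ m \<le> ?src e" for dl m
  proof -
    have "dl / Y / e ^ Suc m \<le> ?s e i" if e: "0 < e" "e \<le> 1" for e
    proof -
      have r: "spr A < spr A + e" using e by simp
      have "dl / e ^ m \<le> e * (\<Sum>k\<in>?C. y k * ?s e k)"
        using dl(2)[OF e] class_resolvent_identity[OF C r y(2)] b unfolding basic_class_def by simp
      also have "(\<Sum>k\<in>?C. y k * ?s e k) \<le> (\<Sum>k\<in>?C. y k / a k * ?s e i)"
      proof (rule sum_mono)
        fix k assume k: "k \<in> ?C"
        have "y k / a k * (a k * ?s e k) \<le> y k / a k * ?s e i"
          using a(1)[OF k] a(2)[OF k e] y(1)[OF k] by (intro mult_left_mono) auto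
        then show "y k * ?s e k \<le> y k / a k * ?s e i" using a(1)[OF k] by simp
      qed
      also have "\<dots> = Y * ?s e i" unfolding Y_def by (simp add: sum_distrib_right)
      finally have "dl / e ^ m \<le> e * (Y * ?s e i)" using e by simp
      then show ?thesis using e Y0 by (simp add: field_simps)
    qed
    moreover have "0 < dl / Y" using dl(1) Y0 by simp
    ultimately show ?thesis by blast
  qed
  show ?case
  proof (cases rule: state_depth_cases[OF A A0 i])
    case 1
    show ?thesis
    proof (cases "basic_class A ?C")
      case True
      \<comment> \<open>No successor contributes here; the constant 1 alone gives a source of order
        \<open>e ^ 0\<close>.\<close>
      have "y i / e ^ 0 \<le> ?src e" if "0 < e" for e
        using class_source_ge(1)[where y = y and k = i and r = "spr A + e", OF C _ y(1) iC] that by simp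
      from basic[OF True y(1)[OF iC] this] show ?thesis using 1 True by simp
    next
      case False
      with 1 have "state_depth A i = 0" by simp
      then show ?thesis using one l0 by (intro exI[of _ "1 / (spr A + 1)"]) auto
    qed
  next
    case (2 j)
    obtain c where c: "0 < c" "\<And>e. 0 < e \<Longrightarrow> e \<le> 1 \<Longrightarrow> c / e ^ state_depth A j \<le> ?s e j"
      using IH[OF 2(1-3)] by blast
    show ?thesis
    proof (cases "basic_class A ?C")
      case True
      \<comment> \<open>A walk from \<open>i\<close> to \<open>j\<close> has to leave the class by
        some arc, and this arc feeds the growth of \<open>j\<close> into the source.\<close>
      have "j \<notin> ?C" using 2 unfolding comm_class_eq[OF A] by auto
      from rtrancl_exit[OF 2(2) iC this] obtain k l where
        kl: "k \<in> ?C" "l \<notin> ?C" "(k, l) \<in> arcs A {..<n}" "(l, j) \<in> ?R" by metis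
      then have kl': "l \<in> {..<n} - ?C" "0 < A $$ (k, l)" unfolding arcs_def by auto
      obtain c' where c': "0 < c'" "\<And>e. 0 < e \<Longrightarrow> e \<le> 1 \<Longrightarrow> c' * ?s e j \<le> ?s e l"
        using resolvent_access[OF kl(4)] by blast
      have "y k * A $$ (k, l) * c' * c / e ^ state_depth A j \<le> ?src e" if e: "0 < e" "e \<le> 1" for e
      proof -
        have r: "spr A < spr A + e" using e by simp
        have "c' * (c / e ^ state_depth A j) \<le> c' * ?s e j"
          using c(2)[OF e] c'(1) by (intro mult_left_mono) auto
        also have "\<dots> \<le> ?s e l" by (rule c'(2)[OF e])
        finally have "y k * A $$ (k, l) * (c' * (c / e ^ state_depth A j)) \<le> y k * A $$ (k, l) * ?s e l"
          using y(1)[OF kl(1)] kl' by (intro mult_left_mono) auto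
        also have "\<dots> \<le> ?src e"
          using class_source_ge(2)[where y = y and k = k and l = l and r = "spr A + e", OF C r y(1) kl(1) kl'(1)]
          by (simp only: mult.assoc)
        finally show ?thesis by (simp add: mult_ac)
      qed
      moreover have "0 < y k * A $$ (k, l) * c' * c" using y(1)[OF kl(1)] kl' c c' by simp
      ultimately show ?thesis using basic[OF True] 2(4) True by simp
    next
      case False
      \<comment> \<open>A class that is not basic adds nothing to the depth, so passing on the rate
        of \<open>j\<close> suffices.\<close>
      obtain c' where c': "0 < c'" "\<And>e. 0 < e \<Longrightarrow> e \<le> 1 \<Longrightarrow> c' * ?s e j \<le> ?s e i"
        using resolvent_access[OF 2(2)] by blast
      have "c' * c / e ^ state_depth A i \<le> ?s e i" if e: "0 < e" "e \<le> 1" for e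
      proof -
        have "c' * (c / e ^ state_depth A j) \<le> c' * ?s e j"
          using c(2)[OF e] c'(1) by (intro mult_left_mono) auto
        with c'(2)[OF e] False 2(4) show ?thesis by simp
      qed
      moreover have "0 < c' * c" using c c' by simp
      ultimately show ?thesis by blast
    qed
  qed
qed

text \<open>In contrast to the lower bound, all arcs leaving the class have to be controlled. Each
  leads to depth at most \<open>p\<close>, so the source is O(e^(-p)), and dividing by the factor of
  the balance costs another 1 / e only for a basic class.\<close>

lemma resolvent_upper:
  assumes "i < n"
  shows "\<exists>c>0. \<forall>e>0. e \<le> 1 \<longrightarrow> resolvent_rowsum A (spr A + e) i \<le> c / e ^ state_depth A i"
  using assms
proof (induction "card {k. k < n \<and> (i, k) \<in> (arcs A {..<n})\<^sup>*}" arbitrary: i rule: less_induct)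
  case less
  note i = less.prems
  let ?R = "(arcs A {..<n})\<^sup>*"
  let ?s = "\<lambda>e. resolvent_rowsum A (spr A + e)"
  let ?C = "comm_class A i"
  let ?m = "spr (submatrix A ?C ?C)"
  have C: "?C \<subseteq> {..<n}" by (rule comm_class_subset[OF A A0])
  have iC: "i \<in> ?C" by (rule comm_class_self[OF A A0 i])
  have fin: "finite ?C" using C finite_subset by blast
  have pos: "0 < ?s e l" if "0 < e" "l < n" for e l
    using resolvent_rowsum_pos(2)[OF A A0 n0 _ that(2)] that(1) by simp
  obtain y where y: "\<And>k. k \<in> ?C \<Longrightarrow> 0 < y k"
    "\<And>j. j \<in> ?C \<Longrightarrow> (\<Sum>k\<in>?C. y k * A $$ (k, j)) = ?m * y j"
    using class_left_eigenvector[OF i] by blast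
  define p where "p = state_depth A i - class_basic A i"
  have p: "state_depth A i = p + class_basic A i"
    unfolding p_def using class_basic_le_depth[OF i] by simp
  \<comment> \<open>The bound is conditional on an arc from the class to \<open>l\<close>: other
    states may have larger depth, but they enter the source with coefficient 0.\<close>
  have "\<exists>c>0. (\<exists>k\<in>?C. 0 < A $$ (k, l)) \<longrightarrow> (\<forall>e>0. e \<le> 1 \<longrightarrow> ?s e l \<le> c / e ^ p)"
    if l: "l \<in> {..<n} - ?C" for l
  proof (cases "\<exists>k\<in>?C. 0 < A $$ (k, l)")
    case True
    then obtain k where k: "k \<in> ?C" "0 < A $$ (k, l)" by auto
    then have "(k, l) \<in> arcs A {..<n}" using C l unfolding arcs_def by auto
    moreover have "(i, k) \<in> ?R" using k unfolding comm_class_eq[OF A] by auto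
    ultimately have il: "(i, l) \<in> ?R" by (rule rtrancl_into_rtrancl[rotated])
    have li: "(l, i) \<notin> ?R" using il l unfolding comm_class_eq[OF A] by auto
    have ln: "l < n" using l by simp
    obtain c where c: "0 < c" "\<And>e. 0 < e \<Longrightarrow> e \<le> 1 \<Longrightarrow> ?s e l \<le> c / e ^ state_depth A l"
      using less.hyps[OF card_reachable_less[OF i il li] ln] by blast
    have dp: "state_depth A l \<le> p" using state_depth_access[OF A A0 i ln il li] p by simp
    have "?s e l \<le> c / e ^ p" if e: "0 < e" "e \<le> 1" for e
    proof -
      have "e ^ p \<le> e ^ state_depth A l" using e dp by (intro power_decreasing) auto
      then have "c / e ^ state_depth A l \<le> c / e ^ p" using c(1) e by (intro divide_left_mono) auto
      with c(2)[OF e] show ?thesis by simp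
    qed
    with c(1) show ?thesis by blast
  qed (auto intro: exI[of _ 1])
  then have "\<exists>a. \<forall>l\<in>{..<n} - ?C. 0 < a l \<and>
      ((\<exists>k\<in>?C. 0 < A $$ (k, l)) \<longrightarrow> (\<forall>e>0. e \<le> 1 \<longrightarrow> ?s e l \<le> a l / e ^ p))"
    by (intro bchoice) blast
  then obtain a where a: "\<And>l. l \<in> {..<n} - ?C \<Longrightarrow> 0 < a l"
    "\<And>k l e. l \<in> {..<n} - ?C \<Longrightarrow> k \<in> ?C \<Longrightarrow> 0 < A $$ (k, l) \<Longrightarrow> 0 < e \<Longrightarrow> e \<le> 1 \<Longrightarrow> ?s e l \<le> a l / e ^ p"
    by blast
  define D where "D = (\<Sum>k\<in>?C. y k * (1 + (\<Sum>l\<in>{..<n} - ?C. A $$ (k, l) * a l)))"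
  have D0: "0 < D" unfolding D_def
  proof (rule sum_pos)
    fix k assume k: "k \<in> ?C"
    have "0 \<le> (\<Sum>l\<in>{..<n} - ?C. A $$ (k, l) * a l)"
      using k C nonneg_matrixD[OF A A0] less_imp_le[OF a(1)] by (intro sum_nonneg mult_nonneg_nonneg) auto
    then show "0 < y k * (1 + (\<Sum>l\<in>{..<n} - ?C. A $$ (k, l) * a l))" using y(1)[OF k] by simp
  qed (use iC fin in auto)
  \<comment> \<open>A lower bound for the factor of the balance: \<open>e\<close> itself for a basic
    class, the positive gap of the spectral radii otherwise.\<close>
  define q where "q = (if basic_class A ?C then 1 else spr A - ?m)"
  have "?m = spr A" if "basic_class A ?C" using that unfolding basic_class_def by simp
  moreover have "?m < spr A" if "\<not> basic_class A ?C"
    using that spr_class_le[OF i] is_class_comm_class[OF A A0 i] unfolding basic_class_def by auto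
  ultimately have q0: "0 < q" and q: "\<And>e. 0 < e \<Longrightarrow> q * e ^ class_basic A i \<le> spr A + e - ?m"
    unfolding q_def by auto
  have "?s e i \<le> D / (q * y i) / e ^ state_depth A i" if e: "0 < e" "e \<le> 1" for e
  proof -
    have r: "spr A < spr A + e" using e by simp
    have "q * e ^ class_basic A i * (y i * ?s e i) \<le> (spr A + e - ?m) * (\<Sum>k\<in>?C. y k * ?s e k)"
    proof (rule mult_mono[OF q[OF e(1)]])
      show "y i * ?s e i \<le> (\<Sum>k\<in>?C. y k * ?s e k)"
        using iC fin C less_imp_le[OF y(1)] less_imp_le[OF pos[OF e(1)]]
        by (intro member_le_sum) (auto intro!: mult_nonneg_nonneg)
      show "0 \<le> spr A + e - ?m" using spr_class_le[OF i] e by simp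
      show "0 \<le> y i * ?s e i" using y(1)[OF iC] pos[OF e(1) i] by simp
    qed
    also have "\<dots> = (\<Sum>k\<in>?C. y k * (1 + (\<Sum>l\<in>{..<n} - ?C. A $$ (k, l) * ?s e l)))"
      by (rule class_resolvent_identity[OF C r y(2)])
    also have "\<dots> \<le> (\<Sum>k\<in>?C. y k * ((1 + (\<Sum>l\<in>{..<n} - ?C. A $$ (k, l) * a l)) / e ^ p))"
    proof (intro sum_mono mult_left_mono)
      fix k assume k: "k \<in> ?C"
      have "(\<Sum>l\<in>{..<n} - ?C. A $$ (k, l) * ?s e l) \<le> (\<Sum>l\<in>{..<n} - ?C. A $$ (k, l) * (a l / e ^ p))"
      proof (rule sum_mono)
        fix l assume l: "l \<in> {..<n} - ?C"
        show "A $$ (k, l) * ?s e l \<le> A $$ (k, l) * (a l / e ^ p)"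
        proof (cases "A $$ (k, l) = 0")
          case False
          then have "0 < A $$ (k, l)" using nonneg_matrixD[OF A A0, of k l] k l C by force
          with a(2)[OF l k this e] show ?thesis by (intro mult_left_mono) auto
        qed simp
      qed
      \<comment> \<open>\<open>e <= 1\<close> lets the constant 1 of the source be absorbed into
        e^(-p).\<close>
      moreover have "1 \<le> 1 / e ^ p" using e by (simp add: power_le_one)
      ultimately show "1 + (\<Sum>l\<in>{..<n} - ?C. A $$ (k, l) * ?s e l)
          \<le> (1 + (\<Sum>l\<in>{..<n} - ?C. A $$ (k, l) * a l)) / e ^ p"
        by (simp add: add_divide_distrib sum_divide_distrib)
      show "0 \<le> y k" using y(1)[OF k] by simp
    qed
    also have "\<dots> = D / e ^ p" unfolding D_def by (simp add: sum_divide_distrib)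
    finally have "q * y i * e ^ class_basic A i * ?s e i \<le> D / e ^ p" by (simp only: mult_ac)
    then have "q * y i * (e ^ p * e ^ class_basic A i) * ?s e i \<le> D"
      using e by (simp only: pos_le_divide_eq zero_less_power mult_ac)
    then have "?s e i * (q * y i * e ^ state_depth A i) \<le> D"
      unfolding p power_add by (simp only: mult_ac)
    moreover have "0 < q * y i * e ^ state_depth A i" using e q0 y(1)[OF iC] by simp
    ultimately show ?thesis by (simp add: pos_le_divide_eq divide_divide_eq_left)
  qed
  moreover have "0 < D / (q * y i)" using D0 q0 y(1)[OF iC] by simp
  ultimately show ?case by blast
qed

lemma resolvent_growth:
  obtains c c' where "0 < c"
    "\<And>e i. \<lbrakk>0 < e; e \<le> 1; i < n\<rbrakk> \<Longrightarrow> c / e ^ state_depth A i \<le> resolvent_rowsum A (spr A + e) i"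
    "\<And>e i. \<lbrakk>0 < e; e \<le> 1; i < n\<rbrakk> \<Longrightarrow> resolvent_rowsum A (spr A + e) i \<le> c' / e ^ state_depth A i"
proof -
  let ?s = "\<lambda>e. resolvent_rowsum A (spr A + e)"
  have "\<exists>c. \<forall>i\<in>{..<n}. 0 < c i \<and> (\<forall>e>0. e \<le> 1 \<longrightarrow> c i / e ^ state_depth A i \<le> ?s e i)"
    by (rule bchoice) (use resolvent_lower in blast)
  then obtain c where c: "\<And>i. i < n \<Longrightarrow> 0 < c i"
    "\<And>i e. i < n \<Longrightarrow> 0 < e \<Longrightarrow> e \<le> 1 \<Longrightarrow> c i / e ^ state_depth A i \<le> ?s e i" by blast
  have "\<exists>c. \<forall>i\<in>{..<n}. 0 < c i \<and> (\<forall>e>0. e \<le> 1 \<longrightarrow> ?s e i \<le> c i / e ^ state_depth A i)"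
    by (rule bchoice) (use resolvent_upper in blast)
  then obtain c' where c': "\<And>i. i < n \<Longrightarrow> 0 < c' i"
    "\<And>i e. i < n \<Longrightarrow> 0 < e \<Longrightarrow> e \<le> 1 \<Longrightarrow> ?s e i \<le> c' i / e ^ state_depth A i" by blast
  show thesis
  proof (rule that[of "Min (c ` {..<n})" "Max (c' ` {..<n})"])
    show "0 < Min (c ` {..<n})" using c(1) n0 by (subst Min_gr_iff) auto
    fix e :: real and i assume e: "0 < e" "e \<le> 1" and i: "i < n"
    have "Min (c ` {..<n}) \<le> c i" "c' i \<le> Max (c' ` {..<n})" using i by auto
    then have "Min (c ` {..<n}) / e ^ state_depth A i \<le> c i / e ^ state_depth A i"
      "c' i / e ^ state_depth A i \<le> Max (c' ` {..<n}) / e ^ state_depth A i"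
      using e by (auto intro!: divide_right_mono)
    with c(2)[OF i e] c'(2)[OF i e]
    show "Min (c ` {..<n}) / e ^ state_depth A i \<le> ?s e i"
      "?s e i \<le> Max (c' ` {..<n}) / e ^ state_depth A i" by linarith+
  qed
qed

end

section \<open>Polynomials near zero and the adjugate\<close>

text \<open>Lexicographic positivity of the coefficients, with the position of the first nonzero
  one; equivalently order \<open>t\<close> at 0 and positive values just to the right of 0.\<close>

definition lowest_term :: "real poly \<Rightarrow> nat \<Rightarrow> bool" where
  "lowest_term f t \<longleftrightarrow> (\<forall>j<t. coeff f j = 0) \<and> 0 < coeff f t"

lemma poly_factor_monom:
  fixes f :: "real poly"
  assumes "f \<noteq> 0"
  obtains t g where "f = monom 1 t * g" "poly g 0 \<noteq> 0"
proof -
  obtain g where g: "f = [:- 0, 1:] ^ order 0 f * g" "\<not> [:- 0, 1:] dvd g"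
    using order_decomp[OF assms] by blast
  have "f = monom 1 (order 0 f) * g" using g(1) by (simp add: monom_altdef)
  moreover have "poly g 0 \<noteq> 0" using g(2) poly_eq_0_iff_dvd by blast
  ultimately show ?thesis using that by blast
qed

lemma lowest_termI:
  assumes "f = monom 1 t * g" "0 < poly g 0"
  shows "lowest_term f t"
  unfolding lowest_term_def assms(1) using assms(2) by (simp add: coeff_monom_mult poly_0_coeff_0)

lemma tendsto_poly_0:
  fixes eps :: "nat \<Rightarrow> real"
  assumes "eps \<longlonglongrightarrow> 0"
  shows "(\<lambda>n. poly g (eps n)) \<longlonglongrightarrow> poly g 0"
  using assms isCont_tendsto_compose[OF poly_isCont] by blast

context
  fixes eps :: "nat \<Rightarrow> real"
  assumes eps0: "eps \<longlonglongrightarrow> 0" and eps_pos: "\<And>n. 0 < eps n"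
begin

text \<open>After splitting off the power of the variable, the cofactor does not vanish at 0, and
  its value there is a limit of nonnegative numbers.\<close>

lemma lowest_term_if_nonneg:
  assumes "f \<noteq> 0" "\<forall>\<^sub>F n in sequentially. 0 \<le> poly f (eps n)"
  obtains t where "lowest_term f t"
proof -
  obtain t g where g: "f = monom 1 t * g" "poly g 0 \<noteq> 0"
    using poly_factor_monom[OF assms(1)] by blast
  have "\<forall>\<^sub>F n in sequentially. 0 \<le> poly g (eps n)"
    using assms(2)
  proof eventually_elim
    case (elim n)
    then show ?case using zero_less_power[OF eps_pos[of n], of t]
      by (simp add: g(1) poly_monom zero_le_mult_iff)
  qed
  then have "0 \<le> poly g 0"
    by (intro tendsto_lowerbound[OF tendsto_poly_0[OF eps0]]) auto
  with g have "0 < poly g 0" by simp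
  from lowest_termI[OF g(1) this] that show ?thesis by blast
qed

text \<open>Write f = e^s g with g(0) nonzero. If s < t, the upper bound forces g(0) <= 0 and the
  lower bound g(0) >= 0; if s > t, the lower bound forces c <= 0. For s = t it gives g(0) >=
  c.\<close>

lemma lowest_term_if_growth:
  assumes "0 < c"
    and lo: "\<forall>\<^sub>F n in sequentially. c * eps n ^ t \<le> poly f (eps n)"
    and up: "\<forall>\<^sub>F n in sequentially. poly f (eps n) \<le> c' * eps n ^ t"
  shows "lowest_term f t"
proof -
  have pw: "(\<lambda>n. eps n ^ Suc k) \<longlonglongrightarrow> 0" for k
    using tendsto_power[OF eps0, of "Suc k"] by simp
  have "f \<noteq> 0"
  proof
    assume "f = 0"
    with lo have "\<forall>\<^sub>F n in sequentially. c * eps n ^ t \<le> 0" by simp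
    then obtain n where "c * eps n ^ t \<le> 0" using eventually_happens by force
    with assms(1) zero_less_power[OF eps_pos[of n], of t] show False
      by (metis mult_pos_pos not_less)
  qed
  then obtain s g where g: "f = monom 1 s * g" "poly g 0 \<noteq> 0"
    using poly_factor_monom by blast
  have f: "poly f e = e ^ s * poly g e" for e by (simp add: g(1) poly_monom)
  note lim = tendsto_poly_0[OF eps0, of g]
  have "s = t"
  proof (rule linorder_cases[of s t])
    assume "s < t"
    then obtain k where k: "t = s + Suc k" using less_imp_Suc_add by auto
    have "\<forall>\<^sub>F n in sequentially. poly g (eps n) \<le> c' * eps n ^ Suc k"
      using up
    proof eventually_elim
      case (elim n)
      then have "eps n ^ s * poly g (eps n) \<le> eps n ^ s * (c' * eps n ^ Suc k)"
        unfolding f k power_add by (simp only: mult_ac)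
      then show ?case using zero_less_power[OF eps_pos[of n], of s] by (simp only: mult_le_cancel_left_pos)
    qed
    then have "poly g 0 \<le> c' * 0"
      by (intro tendsto_le[OF _ tendsto_mult[OF tendsto_const pw] lim]) auto
    moreover have "\<forall>\<^sub>F n in sequentially. 0 \<le> poly g (eps n)"
      using lo
    proof eventually_elim
      case (elim n)
      have "0 \<le> c * eps n ^ t" using assms(1) eps_pos[of n] by simp
      with elim have "0 \<le> eps n ^ s * poly g (eps n)" unfolding f by linarith
      then show ?case using zero_less_power[OF eps_pos[of n], of s] by (simp add: zero_le_mult_iff)
    qed
    then have "0 \<le> poly g 0" by (intro tendsto_lowerbound[OF lim]) auto
    ultimately show ?thesis using g(2) by simp
  next
    assume "t < s"
    then obtain k where k: "s = t + Suc k" using less_imp_Suc_add by auto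
    have "\<forall>\<^sub>F n in sequentially. c \<le> eps n ^ Suc k * poly g (eps n)"
      using lo
    proof eventually_elim
      case (elim n)
      then have "eps n ^ t * c \<le> eps n ^ t * (eps n ^ Suc k * poly g (eps n))"
        unfolding f k power_add by (simp only: mult_ac)
      then show ?case using zero_less_power[OF eps_pos[of n], of t] by (simp only: mult_le_cancel_left_pos)
    qed
    then have "c \<le> 0 * poly g 0"
      by (intro tendsto_lowerbound[OF tendsto_mult[OF pw lim]]) auto
    with assms(1) show ?thesis by simp
  qed
  have "\<forall>\<^sub>F n in sequentially. c \<le> poly g (eps n)"
    using lo
  proof eventually_elim
    case (elim n)
    then have "eps n ^ t * c \<le> eps n ^ t * poly g (eps n)"
      unfolding f \<open>s = t\<close> by (simp only: mult_ac)
    then show ?case using zero_less_power[OF eps_pos[of n], of t] by (simp only: mult_le_cancel_left_pos)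
  qed
  then have "c \<le> poly g 0" by (intro tendsto_lowerbound[OF lim]) auto
  with assms(1) have "0 < poly g 0" by simp
  from lowest_termI[OF g(1) this] show ?thesis unfolding \<open>s = t\<close> .
qed

end

text \<open>The coefficient of \<open>\<epsilon>\<^sup>t\<close> in the power series \<open>f(\<epsilon>) / (1 - M \<epsilon>)\<close>.\<close>

primrec geom_coeff :: "real \<Rightarrow> real poly \<Rightarrow> nat \<Rightarrow> real" where
  "geom_coeff M f 0 = coeff f 0"
| "geom_coeff M f (Suc t) = M * geom_coeff M f t + coeff f (Suc t)"

lemma geom_coeff_add: "geom_coeff M (f + g) t = geom_coeff M f t + geom_coeff M g t"
  by (induction t) (simp_all add: algebra_simps)

lemma geom_coeff_smult: "geom_coeff M (Polynomial.smult a f) t = a * geom_coeff M f t"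
  by (induction t) (simp_all add: algebra_simps)

lemma geom_coeff_0: "geom_coeff M 0 t = 0"
  by (induction t) simp_all

lemma geom_coeff_sum: "geom_coeff M (\<Sum>i\<in>I. f i) t = (\<Sum>i\<in>I. geom_coeff M (f i) t)"
  by (induction I rule: infinite_finite_induct) (simp_all add: geom_coeff_add geom_coeff_0)

lemma geom_coeff_eq_0: "(\<And>j. j \<le> t \<Longrightarrow> coeff f j = 0) \<Longrightarrow> geom_coeff M f t = 0"
  by (induction t) simp_all

text \<open>Multiplication by the variable shifts the index by one even after division by 1 - M e,
  because power series commute. This is where the chain relations come from.\<close>

lemma geom_coeff_linear_mult:
  "geom_coeff M ([:a, 1:] * f) t =
    a * geom_coeff M f t + (case t of 0 \<Rightarrow> 0 | Suc s \<Rightarrow> geom_coeff M f s)"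
proof -
  have "geom_coeff M (pCons 0 f) t = (case t of 0 \<Rightarrow> 0 | Suc s \<Rightarrow> geom_coeff M f s)"
    by (induction t) (simp_all split: nat.split)
  moreover have "[:a, 1:] * f = Polynomial.smult a f + pCons 0 f" by simp
  ultimately show ?thesis by (simp only: geom_coeff_add geom_coeff_smult)
qed

lemma geom_coeff_pos:
  assumes "lowest_term f t"
  shows "\<exists>M0. \<forall>M\<ge>M0. \<forall>s\<ge>t. 0 < geom_coeff M f s"
proof -
  define S where "S = (\<Sum>j\<le>degree f. \<bar>coeff f j\<bar>)"
  have S: "\<bar>coeff f j\<bar> \<le> S" for j
  proof (cases "j \<le> degree f")
    case True
    then show ?thesis unfolding S_def by (intro member_le_sum) auto
  next
    case False
    then show ?thesis unfolding S_def by (simp add: coeff_eq_0 sum_nonneg)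
  qed
  have S0: "0 \<le> S" using S[of 0] by simp
  have ft: "0 < coeff f t" and low: "\<And>j. j < t \<Longrightarrow> coeff f j = 0"
    using assms unfolding lowest_term_def by auto
  \<comment> \<open>The threshold makes \<open>M * coeff f t\<close> at least
    \<open>coeff f t + S\<close>. The next coefficient takes away at most \<open>S\<close>, so the
    bound reproduces itself.\<close>
  have "coeff f t \<le> geom_coeff M f s" if M: "1 + S / coeff f t \<le> M" and s: "t \<le> s" for M s
    using s
  proof (induction rule: dec_induct)
    case base
    then show ?case using low geom_coeff_eq_0[of _ f M] by (cases t) auto
  next
    case (step s)
    have M0: "0 \<le> M" using M S0 ft by (smt (verit) divide_nonneg_pos)
    have "coeff f t + S = (1 + S / coeff f t) * coeff f t" using ft by (simp add: field_simps)
    also have "\<dots> \<le> M * coeff f t" using M ft by (intro mult_right_mono) auto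
    also have "\<dots> \<le> M * geom_coeff M f s" using step.IH M0 by (rule mult_left_mono)
    finally show ?case using S[of "Suc s"] by simp
  qed
  with ft show ?thesis by (meson less_le_trans)
qed

text \<open>\<open>q\<close> is det (r - A) and \<open>p\<close> consists of the row sums of the
  adjugate, as polynomials in r. The adjugate as right factor gives the polynomial identity, as left
  factor the evaluation. No inverse is taken, so the evaluation also covers roots of
  \<open>q\<close>.\<close>

lemma adjugate_rowsum:
  fixes A :: "real mat"
  assumes A: "A \<in> carrier_mat n n"
  obtains p :: "nat \<Rightarrow> real poly" and q
  where "q \<noteq> 0" "\<forall>i<n. [:0, 1:] * p i = q + (\<Sum>j<n. Polynomial.smult (A $$ (i, j)) (p j))"
    "\<forall>r x. (\<forall>i<n. r * x i = 1 + (\<Sum>j<n. A $$ (i, j) * x j)) \<longrightarrow>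
      (\<forall>i<n. poly (p i) r = poly q r * x i)"
proof -
  define C where "C = char_poly_matrix A"
  define D where "D = adj_mat C"
  define q where "q = char_poly A"
  define p where "p i = (\<Sum>j<n. D $$ (i, j))" for i
  have C: "C \<in> carrier_mat n n" unfolding C_def using A by simp
  have D: "D \<in> carrier_mat n n" unfolding D_def by (rule adj_mat(1)[OF C])
  have Cij: "C $$ (i, j) = (if i = j then [:0, 1:] else 0) - [:A $$ (i, j):]" if "i < n" "j < n" for i j
    unfolding C_def char_poly_matrix_def using A that by auto
  have qdet: "q = det C" unfolding q_def char_poly_def C_def ..
  have CD: "(\<Sum>k<n. C $$ (i, k) * D $$ (k, j)) = (if i = j then q else 0)" if "i < n" "j < n" for i j
    using times_mat_entry[OF C D that] that
    unfolding D_def adj_mat(2)[OF C] by (auto simp: qdet)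
  have DC: "(\<Sum>k<n. D $$ (i, k) * C $$ (k, j)) = (if i = j then q else 0)" if "i < n" "j < n" for i j
    using times_mat_entry[OF D C that] that
    unfolding D_def adj_mat(3)[OF C] by (auto simp: qdet)
  show thesis
  proof (rule that[of q p])
    show "q \<noteq> 0" using degree_monic_char_poly[OF A] unfolding q_def by auto
  next
    show "\<forall>i<n. [:0, 1:] * p i = q + (\<Sum>j<n. Polynomial.smult (A $$ (i, j)) (p j))"
    proof (intro allI impI)
      fix i assume i: "i < n"
      have "q = (\<Sum>j<n. \<Sum>k<n. C $$ (i, k) * D $$ (k, j))" using CD i by simp
      also have "\<dots> = (\<Sum>k<n. C $$ (i, k) * p k)"
        unfolding p_def sum_distrib_left by (rule sum.swap)
      also have "\<dots> = (\<Sum>k<n. (if i = k then [:0, 1:] * p k else 0) - Polynomial.smult (A $$ (i, k)) (p k))"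
        using i by (intro sum.cong) (auto simp: Cij left_diff_distrib)
      also have "\<dots> = [:0, 1:] * p i - (\<Sum>k<n. Polynomial.smult (A $$ (i, k)) (p k))"
        using i by (simp add: sum_subtractf)
      finally show "[:0, 1:] * p i = q + (\<Sum>j<n. Polynomial.smult (A $$ (i, j)) (p j))" by simp
    qed
  next
    show "\<forall>r x. (\<forall>i<n. r * x i = 1 + (\<Sum>j<n. A $$ (i, j) * x j)) \<longrightarrow>
      (\<forall>i<n. poly (p i) r = poly q r * x i)"
    proof (intro allI impI)
      fix r :: real and x i
      assume x: "\<forall>i<n. r * x i = 1 + (\<Sum>j<n. A $$ (i, j) * x j)" and i: "i < n"
      have "poly q r * x i = (\<Sum>l<n. (if i = l then poly q r else 0) * x l)"
        using i by (simp add: if_distrib[of "\<lambda>a. a * _"] cong: if_cong)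
      also have "\<dots> = (\<Sum>l<n. (\<Sum>k<n. poly (D $$ (i, k)) r * poly (C $$ (k, l)) r) * x l)"
      proof (intro sum.cong refl)
        fix l assume "l \<in> {..<n}"
        then have "poly (\<Sum>k<n. D $$ (i, k) * C $$ (k, l)) r = (if i = l then poly q r else 0)"
          using DC[OF i] by simp
        then show "(if i = l then poly q r else 0) * x l
            = (\<Sum>k<n. poly (D $$ (i, k)) r * poly (C $$ (k, l)) r) * x l"
          by (simp add: poly_sum)
      qed
      also have "\<dots> = (\<Sum>k<n. poly (D $$ (i, k)) r * (\<Sum>l<n. poly (C $$ (k, l)) r * x l))"
        unfolding sum_distrib_left sum_distrib_right by (subst sum.swap) (simp only: mult.assoc)
      also have "\<dots> = (\<Sum>k<n. poly (D $$ (i, k)) r)"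
      proof (intro sum.cong refl)
        fix k assume k: "k \<in> {..<n}"
        have "(\<Sum>l<n. poly (C $$ (k, l)) r * x l)
            = (\<Sum>l<n. (if k = l then r * x l else 0) - A $$ (k, l) * x l)"
          using k by (intro sum.cong) (auto simp: Cij algebra_simps)
        also have "\<dots> = 1" using k x by (simp add: sum_subtractf)
        finally show "poly (D $$ (i, k)) r * (\<Sum>l<n. poly (C $$ (k, l)) r * x l) = poly (D $$ (i, k)) r"
          by simp
      qed
      also have "\<dots> = poly (p i) r" unfolding p_def by (simp add: poly_sum)
      finally show "poly (p i) r = poly q r * x i" by simp
    qed
  qed
qed

text \<open>The substitution r = a + e moves the expansion point to 0. There \<open>q\<close> is e^m
  times a factor with positive limit and x_i has order e^(-d i), so p_i = q x_i has order m - d i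
  with positive lowest coefficient.\<close>

lemma resolvent_polynomials:
  fixes A :: "real mat" and eps :: "nat \<Rightarrow> real" and d :: "nat \<Rightarrow> nat"
  assumes A: "A \<in> carrier_mat n n"
    and eps0: "eps \<longlonglongrightarrow> 0" and eps_pos: "\<And>k. 0 < eps k"
    and x: "\<And>k i. i < n \<Longrightarrow> (a + eps k) * x k i = 1 + (\<Sum>j<n. A $$ (i, j) * x k j)"
    and c: "0 < c" "\<And>k i. i < n \<Longrightarrow> c / eps k ^ d i \<le> x k i" "\<And>k i. i < n \<Longrightarrow> x k i \<le> c' / eps k ^ d i"
    and d: "\<And>i. i < n \<Longrightarrow> d i \<le> v"
  obtains p :: "nat \<Rightarrow> real poly" and q m
  where "v \<le> m" "\<And>j. j < m \<Longrightarrow> coeff q j = 0"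
    "\<And>i. i < n \<Longrightarrow> [:a, 1:] * p i = q + (\<Sum>j<n. Polynomial.smult (A $$ (i, j)) (p j))"
    "\<And>i. i < n \<Longrightarrow> lowest_term (p i) (m - d i)"
    "\<forall>\<^sub>F k in sequentially. 0 < poly q (eps k)"
    "\<And>k i. i < n \<Longrightarrow> poly (p i) (eps k) = poly q (eps k) * x k i"
proof -
  obtain p0 q0 where q0: "q0 \<noteq> 0"
    and p0: "\<forall>i<n. [:0, 1:] * p0 i = q0 + (\<Sum>j<n. Polynomial.smult (A $$ (i, j)) (p0 j))"
    and px0: "\<forall>r x. (\<forall>i<n. r * x i = 1 + (\<Sum>j<n. A $$ (i, j) * x j)) \<longrightarrow>
      (\<forall>i<n. poly (p0 i) r = poly q0 r * x i)"
    by (rule adjugate_rowsum[OF A], rule that)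
  define p1 where "p1 i = pcompose (p0 i) [:a, 1:]" for i
  define q1 where "q1 = pcompose q0 [:a, 1:]"
  have "q1 \<noteq> 0" unfolding q1_def using q0 pcompose_eq_0[of q0 "[:a, 1:]"] by auto
  then obtain t g where g: "q1 = monom 1 t * g" "poly g 0 \<noteq> 0"
    using poly_factor_monom by blast
  define h where "h = Polynomial.smult (sgn (poly g 0)) g"
  \<comment> \<open>The sign makes \<open>q\<close> eventually positive along \<open>eps\<close>, so
    that passing from x to \<open>p\<close> preserves inequalities. The factor e^v gives
    \<open>d i <= v <= m\<close>, so \<open>m - d i\<close> is not truncated.\<close>
  define q where "q = monom (sgn (poly g 0)) v * q1"
  define p where "p i = monom (sgn (poly g 0)) v * p1 i" for i
  define m where "m = v + t"
  have h0: "0 < poly h 0" unfolding h_def using g(2) by (simp add: sgn_if)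
  have q: "q = monom 1 m * h"
  proof -
    have "q = monom (sgn (poly g 0)) m * g"
      unfolding q_def m_def g(1) by (simp only: mult.assoc[symmetric] mult_monom mult_1_right)
    also have "monom (sgn (poly g 0)) m = Polynomial.smult (sgn (poly g 0)) (monom 1 m)"
      by (simp add: smult_monom)
    finally show ?thesis unfolding h_def by simp
  qed
  have p1: "[:a, 1:] * p1 i = q1 + (\<Sum>j<n. Polynomial.smult (A $$ (i, j)) (p1 j))" if "i < n" for i
  proof -
    have "pcompose ([:0, 1:] * p0 i) [:a, 1:] = pcompose (q0 + (\<Sum>j<n. Polynomial.smult (A $$ (i, j)) (p0 j))) [:a, 1:]"
      using p0 that by simp
    then show ?thesis
      by (simp only: pcompose_mult pcompose_add pcompose_sum pcompose_smult p1_def q1_def pcompose_idR pcompose_pCons) simp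
  qed
  have px: "poly (p i) (eps k) = poly q (eps k) * x k i" if "i < n" for i k
    using px0[rule_format, of "a + eps k" "x k" i] x that
    by (simp add: p_def q_def p1_def q1_def poly_pcompose mult.assoc)
  note lim = tendsto_poly_0[OF eps0, of h]
  have qe: "poly q e = e ^ m * poly h e" for e by (simp add: q poly_monom)
  have hpos: "\<forall>\<^sub>F k in sequentially. poly h 0 / 2 < poly h (eps k)"
    by (rule order_tendstoD(1)[OF lim]) (use h0 in simp)
  have hup: "\<forall>\<^sub>F k in sequentially. poly h (eps k) < 2 * poly h 0"
    by (rule order_tendstoD(2)[OF lim]) (use h0 in simp)
  show thesis
  proof (rule that[of m q p])
    show "v \<le> m" unfolding m_def by simp
    show "coeff q j = 0" if "j < m" for j unfolding q using that by (simp add: coeff_monom_mult)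
    show "[:a, 1:] * p i = q + (\<Sum>j<n. Polynomial.smult (A $$ (i, j)) (p j))" if "i < n" for i
    proof -
      have "[:a, 1:] * p i = monom (sgn (poly g 0)) v * ([:a, 1:] * p1 i)"
        unfolding p_def by (simp only: mult_ac)
      also have "\<dots> = q + (\<Sum>j<n. Polynomial.smult (A $$ (i, j)) (p j))"
        unfolding p1[OF that] q_def p_def by (simp add: distrib_left sum_distrib_left)
      finally show ?thesis .
    qed
    show "\<forall>\<^sub>F k in sequentially. 0 < poly q (eps k)"
      using hpos
    proof eventually_elim
      case (elim k)
      with h0 have "0 < poly h (eps k)" by linarith
      then show ?case unfolding qe using eps_pos[of k] by simp
    qed
    show "lowest_term (p i) (m - d i)" if i: "i < n" for i
    proof (rule lowest_term_if_growth[OF eps0 eps_pos])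
      have m: "e ^ m = e ^ (m - d i) * e ^ d i" for e :: real
        using d[OF i] by (simp add: m_def power_add[symmetric])
      have eq: "poly (p i) (eps k) = poly h (eps k) * (x k i * eps k ^ d i) * eps k ^ (m - d i)" for k
        unfolding px[OF i] qe m by (simp only: mult_ac)
      have xl: "c \<le> x k i * eps k ^ d i" and xu: "x k i * eps k ^ d i \<le> c'" for k
        using c(2)[OF i, of k] c(3)[OF i, of k] eps_pos[of k]
        by (simp_all add: pos_divide_le_eq pos_le_divide_eq)
      show "0 < poly h 0 / 2 * c" using h0 c(1) by simp
      show "\<forall>\<^sub>F k in sequentially. poly h 0 / 2 * c * eps k ^ (m - d i) \<le> poly (p i) (eps k)"
        using hpos
      proof eventually_elim
        case (elim k)
        show ?case unfolding eq using elim h0 c(1) xl[of k] eps_pos[of k]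
          by (intro mult_right_mono mult_mono) auto
      qed
      show "\<forall>\<^sub>F k in sequentially. poly (p i) (eps k) \<le> 2 * poly h 0 * c' * eps k ^ (m - d i)"
        using hpos hup
      proof eventually_elim
        case (elim k)
        then show ?case unfolding eq using h0 c(1) xl[of k] xu[of k] eps_pos[of k]
          by (intro mult_right_mono mult_mono) auto
      qed
    qed
  qed (use px in auto)
qed

section \<open>Optimal fixed points\<close>

text \<open>Finiteness gives a minimiser for each row separately; the product property splices them,
  one row at a time, into a single member of \<open>K\<close>.\<close>

lemma row_minimizer:
  assumes K: "finite K" "K \<noteq> {}" "K \<subseteq> carrier_mat n n" and pp: "product_property n K"
  shows "\<exists>A\<in>K. \<forall>A'\<in>K. \<forall>i<n. (\<Sum>j<n. A $$ (i, j) * x j) \<le> (\<Sum>j<n. A' $$ (i, j) * x j)"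
proof -
  let ?s = "\<lambda>A i. \<Sum>j<n. A $$ (i, j) * x j"
  have "\<exists>A\<in>K. \<forall>A'\<in>K. \<forall>i<m. ?s A i \<le> ?s A' i" if "m \<le> n" for m
    using that
  proof (induction m)
    case 0
    then show ?case using K(2) by auto
  next
    case (Suc m)
    then obtain A where A: "A \<in> K" "\<And>A' i. A' \<in> K \<Longrightarrow> i < m \<Longrightarrow> ?s A i \<le> ?s A' i" by auto
    have "Min ((\<lambda>A. ?s A m) ` K) \<in> (\<lambda>A. ?s A m) ` K" using K by (intro Min_in) auto
    then obtain A2 where A2: "A2 \<in> K" "Min ((\<lambda>A. ?s A m) ` K) = ?s A2 m" by auto
    have A2m: "?s A2 m \<le> ?s A' m" if "A' \<in> K" for A'
      using K that unfolding A2(2)[symmetric] by (intro Min_le) auto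
    define B where "B = mat n n (\<lambda>(i, j). if i \<in> {m} then A2 $$ (i, j) else A $$ (i, j))"
    have "B \<in> K"
      using pp[unfolded product_property_def, rule_format, of "{m}" A2 A] A(1) A2(1) Suc.prems
      unfolding B_def by auto
    moreover have "?s B i \<le> ?s A' i" if "A' \<in> K" "i < Suc m" for A' i
    proof (cases "i = m")
      case True
      then have "?s B i = ?s A2 m" unfolding B_def using Suc.prems by (intro sum.cong) auto
      then show ?thesis using A2m[OF that(1)] True by simp
    next
      case False
      then have "?s B i = ?s A i" unfolding B_def using that Suc.prems by (intro sum.cong) auto
      then show ?thesis using A(2)[OF that(1), of i] that(2) False by simp
    qed
    ultimately show ?case by blast
  qed
  from this[of n] show ?thesis by simp
qed

lemma finite_range_constant_subseq:
  assumes "finite K" "\<And>k. f k \<in> K"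
  obtains a g where "a \<in> K" "strict_mono (g :: nat \<Rightarrow> nat)" "\<And>k. f (g k) = a"
proof -
  have "finite (f ` UNIV)" using assms by (auto intro: finite_subset)
  then obtain k0 where "infinite {k \<in> UNIV. f k = f k0}"
    using pigeonhole_infinite[of UNIV f] by auto
  then obtain g where "strict_mono (g :: nat \<Rightarrow> nat)" "\<And>k. g k \<in> {k. f k = f k0}"
    using infinite_enumerate by (metis (no_types, lifting) Collect_cong UNIV_I)
  then show ?thesis using that assms(2)[of k0] by auto
qed

text \<open>Value iteration increases when started at 0, and the supersolution \<open>u\<close> of
  the single matrix \<open>B\<close> bounds it, since minimising over \<open>K\<close> can only
  lower the iterates.\<close>

lemma optimal_fixed_point:
  fixes u :: "nat \<Rightarrow> real"
  assumes K: "finite K" "K \<noteq> {}" "K \<subseteq> carrier_mat n n" and K0: "\<And>A. A \<in> K \<Longrightarrow> nonneg_matrix A"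
    and pp: "product_property n K" and r: "0 < r"
    and B: "B \<in> K" and u: "\<And>i. i < n \<Longrightarrow> 0 \<le> u i"
      "\<And>i. i < n \<Longrightarrow> 1 + (\<Sum>j<n. B $$ (i, j) * u j) \<le> r * u i"
  obtains A x where "A \<in> K" "\<And>i. i < n \<Longrightarrow> 0 \<le> x i" "\<And>i. i < n \<Longrightarrow> x i \<le> u i"
    "\<And>i. i < n \<Longrightarrow> r * x i = 1 + (\<Sum>j<n. A $$ (i, j) * x j)"
    "\<And>A' i. A' \<in> K \<Longrightarrow> i < n \<Longrightarrow> (\<Sum>j<n. A $$ (i, j) * x j) \<le> (\<Sum>j<n. A' $$ (i, j) * x j)"
proof -
  let ?s = "\<lambda>A x i. \<Sum>j<n. A $$ (i, j) * x j"
  have "\<forall>x. \<exists>A. A \<in> K \<and> (\<forall>A'\<in>K. \<forall>i<n. ?s A x i \<le> ?s A' x i)"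
    using row_minimizer[OF K pp] by blast
  then obtain F where F: "\<And>x. F x \<in> K" "\<And>x A' i. A' \<in> K \<Longrightarrow> i < n \<Longrightarrow> ?s (F x) x i \<le> ?s A' x i"
    by metis
  have mono: "?s A x i \<le> ?s A y i" if "A \<in> K" "i < n" "\<And>j. j < n \<Longrightarrow> x j \<le> y j" for A x y i
    using nonneg_matrixD[OF _ K0[OF that(1)]] K(3) that by (intro sum_mono mult_left_mono) auto
  define X where "X = rec_nat (\<lambda>_. 0 :: real) (\<lambda>_ x i. (1 + ?s (F x) x i) / r)"
  have X0: "X 0 i = 0" and XS: "X (Suc k) i = (1 + ?s (F (X k)) (X k) i) / r" for k i
    unfolding X_def by simp_all
  have XK: "X (Suc k) i \<le> (1 + ?s A' (X k) i) / r" if "A' \<in> K" "i < n" for k i A'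
    unfolding XS using F(2)[OF that] r by (intro divide_right_mono) auto
  have up: "X k i \<le> u i" if "i < n" for k i
    using that
  proof (induction k arbitrary: i)
    case (Suc k)
    have "X (Suc k) i \<le> (1 + ?s B (X k) i) / r" by (rule XK[OF B Suc.prems])
    also have "\<dots> \<le> (1 + ?s B u i) / r"
      using mono[OF B Suc.prems Suc.IH] r by (intro divide_right_mono) auto
    also have "\<dots> \<le> u i" using u(2)[OF Suc.prems] r by (simp add: pos_divide_le_eq mult.commute)
    finally show ?case .
  qed (use u(1) X0 in simp)
  have inc: "0 \<le> X k i \<and> X k i \<le> X (Suc k) i" if "i < n" for k i
    using that
  proof (induction k arbitrary: i)
    case 0
    have "?s (F (X 0)) (X 0) i = 0" by (simp add: X0)
    then show ?case using r by (simp add: X0 XS)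
  next
    case (Suc k)
    have "X (Suc k) i \<le> (1 + ?s (F (X (Suc k))) (X k) i) / r" by (rule XK[OF F(1) Suc.prems])
    also have "\<dots> \<le> X (Suc (Suc k)) i"
      unfolding XS[of "Suc k"] using mono[OF F(1) Suc.prems, of "X k" "X (Suc k)"] Suc.IH r
      by (intro divide_right_mono) auto
    finally show ?case using Suc.IH[OF Suc.prems] by simp
  qed
  have "convergent (\<lambda>k. X k i)" if "i < n" for i
  proof (rule Bseq_mono_convergent)
    show "Bseq (\<lambda>k. X k i)"
      by (rule BseqI'[of _ "u i"]) (use inc[OF that] up[OF that] in auto)
    show "\<forall>m k. m \<le> k \<longrightarrow> X m i \<le> X k i"
      using lift_Suc_mono_le[of "\<lambda>k. X k i"] inc[OF that] by blast
  qed
  then have "\<forall>i. \<exists>l. i < n \<longrightarrow> (\<lambda>k. X k i) \<longlonglongrightarrow> l" unfolding convergent_def by blast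
  then obtain x where x: "\<And>i. i < n \<Longrightarrow> (\<lambda>k. X k i) \<longlonglongrightarrow> x i" by metis
  \<comment> \<open>One minimiser serves infinitely many iterates. Along these the recursion is
    affine with the fixed matrix \<open>A\<close>, and its limit is the equation for
    \<open>x\<close>.\<close>
  obtain A g where A: "A \<in> K" and g: "strict_mono (g :: nat \<Rightarrow> nat)" "\<And>k. F (X (g k)) = A"
    using finite_range_constant_subseq[OF K(1), of "\<lambda>k. F (X k)"] F(1) by metis
  have lim: "(\<lambda>k. (1 + ?s A' (X k) i) / r) \<longlonglongrightarrow> (1 + ?s A' x i) / r" for A' i
    using r by (intro tendsto_divide tendsto_add tendsto_sum tendsto_mult tendsto_const x) auto
  have limS: "(\<lambda>k. X (Suc k) i) \<longlonglongrightarrow> x i" if "i < n" for i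
    using LIMSEQ_Suc[OF x[OF that]] .
  have eq: "x i = (1 + ?s A x i) / r" if i: "i < n" for i
  proof -
    have "(\<lambda>k. X (Suc (g k)) i) \<longlonglongrightarrow> x i"
      using LIMSEQ_subseq_LIMSEQ[OF limS[OF i] g(1)] by (simp add: o_def)
    moreover have "(\<lambda>k. X (Suc (g k)) i) \<longlonglongrightarrow> (1 + ?s A x i) / r"
      using LIMSEQ_subseq_LIMSEQ[OF lim g(1), of A i] by (simp add: o_def XS g(2))
    ultimately show ?thesis by (rule LIMSEQ_unique)
  qed
  show thesis
  proof (rule that[OF A])
    fix i assume i: "i < n"
    show "0 \<le> x i" by (rule LIMSEQ_le_const[OF x[OF i]]) (use inc[OF i] in auto)
    show "x i \<le> u i" by (rule LIMSEQ_le_const2[OF x[OF i]]) (use up[OF i] in auto)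
    show rx: "r * x i = 1 + ?s A x i" using eq[OF i] r by (simp add: field_simps)
    fix A' assume A': "A' \<in> K"
    \<comment> \<open>Every \<open>A'\<close> bounds each iteration step from above; the limit of
      these bounds is the minimality of \<open>A\<close> at \<open>x\<close>.\<close>
    have "x i \<le> (1 + ?s A' x i) / r"
      by (rule LIMSEQ_le[OF limS[OF i] lim]) (use XK[OF A' i] in auto)
    then show "?s A x i \<le> ?s A' x i" using rx r by (simp add: field_simps)
  qed
qed

text \<open>Iterating x = (1 + A x) / r and dropping the nonnegative remainder. Nothing relates
  \<open>r\<close> to \<open>spr A\<close> here, so the comparison is with partial sums and not with
  \<open>resolvent_rowsum A r\<close>.\<close>

lemma fixed_point_ge_partial:
  assumes A: "A \<in> carrier_mat n n" and A0: "nonneg_matrix A" and r: "0 < r"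
    and x: "\<And>i. i < n \<Longrightarrow> 0 \<le> x i" "\<And>i. i < n \<Longrightarrow> r * x i = 1 + (\<Sum>j<n. A $$ (i, j) * x j)"
    and i: "i < n"
  shows "(\<Sum>k<m. pow_rowsum A k i / r ^ Suc k) \<le> x i"
  using i
proof (induction m arbitrary: i)
  case (Suc m)
  have "(\<Sum>k<Suc m. pow_rowsum A k i / r ^ Suc k)
      = 1 / r + (\<Sum>k<m. \<Sum>j<n. A $$ (i, j) * (pow_rowsum A k j / r ^ Suc k) / r)"
    unfolding sum.lessThan_Suc_shift pow_rowsum_0[OF A Suc.prems] pow_rowsum_Suc[OF A Suc.prems]
    by (simp add: sum_divide_distrib mult_ac)
  also have "\<dots> = (1 + (\<Sum>j<n. A $$ (i, j) * (\<Sum>k<m. pow_rowsum A k j / r ^ Suc k))) / r"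
    unfolding sum_distrib_left add_divide_distrib sum_divide_distrib by (subst sum.swap) simp
  also have "\<dots> \<le> (1 + (\<Sum>j<n. A $$ (i, j) * x j)) / r"
    using Suc nonneg_matrixD[OF A A0] r
    by (intro divide_right_mono add_left_mono sum_mono mult_left_mono) auto
  also have "\<dots> = x i" using x(2)[OF Suc.prems] r by (simp add: field_simps)
  finally show ?case .
qed (use x in simp)

text \<open>Minimality compares B^k 1 with A^k 1 from some \<open>k0\<close> on, which bounds the
  tail of the series for \<open>B\<close> by \<open>q\<close> times partial sums for
  \<open>A\<close>, hence by \<open>q * x i\<close>. The finitely many earlier terms are absorbed by
  \<open>x i >= 1 / r\<close>.\<close>

lemma resolvent_le_of_growth:
  assumes A: "A \<in> carrier_mat n n" and A0: "nonneg_matrix A"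
    and B: "B \<in> carrier_mat n n" and B0: "nonneg_matrix B" and n0: "0 < n"
    and l0: "0 < spr B"
    and gr: "growth_le (\<lambda>k. B ^\<^sub>m k *\<^sub>v vec n (\<lambda>_. 1)) (\<lambda>k. A ^\<^sub>m k *\<^sub>v vec n (\<lambda>_. 1))"
  obtains c where "0 < c"
    "\<forall>r>spr B. \<forall>x. (\<forall>i<n. 0 \<le> x i \<and> r * x i = 1 + (\<Sum>j<n. A $$ (i, j) * x j)) \<longrightarrow>
      (\<forall>i<n. resolvent_rowsum B r i \<le> c * x i)"
proof -
  let ?b = "pow_rowsum B" and ?a = "pow_rowsum A"
  have ent: "(C ^\<^sub>m k *\<^sub>v vec n (\<lambda>_. 1)) $ i = pow_rowsum C k i"
    if "C \<in> carrier_mat n n" "i < n" for C :: "real mat" and k i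
    using mult_mat_vec_entry[OF pow_carrier_mat[OF that(1)] _ that(2), of "vec n (\<lambda>_. 1)" k] that
    by (simp add: pow_rowsum_def)
  obtain q k0 where q: "0 < q"
    "\<And>k. k0 \<le> k \<Longrightarrow> B ^\<^sub>m k *\<^sub>v vec n (\<lambda>_. 1) \<le> q \<cdot>\<^sub>v (A ^\<^sub>m k *\<^sub>v vec n (\<lambda>_. 1))"
    using gr unfolding growth_le_def eventually_sequentially by auto
  have ba: "?b k i \<le> q * ?a k i" if "k0 \<le> k" "i < n" for k i
  proof -
    have "(B ^\<^sub>m k *\<^sub>v vec n (\<lambda>_. 1)) $ i \<le> (q \<cdot>\<^sub>v (A ^\<^sub>m k *\<^sub>v vec n (\<lambda>_. 1))) $ i"
      using q(2)[OF that(1)] that(2) A pow_carrier_mat[OF A, of k] unfolding less_eq_vec_def by auto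
    then show ?thesis
      using ent[OF A that(2), of k] ent[OF B that(2), of k] that(2) pow_carrier_mat[OF A, of k] by auto
  qed
  note b0 = pow_rowsum_nonneg[OF B B0 n0] and a0 = pow_rowsum_nonneg[OF A A0 n0]
  \<comment> \<open>Dividing by powers of \<open>spr B\<close> instead of \<open>r\<close> makes the
    bound on the first \<open>k0\<close> terms uniform in \<open>r > spr B\<close>.\<close>
  define T where "T = (\<Sum>i<n. \<Sum>k<k0. ?b k i / spr B ^ k)"
  have T: "(\<Sum>k<k0. ?b k i / spr B ^ k) \<le> T" if "i < n" for i
    unfolding T_def using that b0 l0 by (intro member_le_sum) (auto intro!: sum_nonneg)
  have T0: "0 \<le> T" unfolding T_def using b0 l0 by (auto intro!: sum_nonneg)
  show thesis
  proof (rule that[of "T + q"])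
    show "0 < T + q" using T0 q(1) by simp
    show "\<forall>r>spr B. \<forall>x. (\<forall>i<n. 0 \<le> x i \<and> r * x i = 1 + (\<Sum>j<n. A $$ (i, j) * x j)) \<longrightarrow>
      (\<forall>i<n. resolvent_rowsum B r i \<le> (T + q) * x i)"
    proof (intro allI impI)
      fix r x i assume r: "spr B < r" and "\<forall>i<n. 0 \<le> x i \<and> r * x i = 1 + (\<Sum>j<n. A $$ (i, j) * x j)"
        and i: "i < n"
      then have x: "\<And>i. i < n \<Longrightarrow> 0 \<le> x i" "\<And>i. i < n \<Longrightarrow> r * x i = 1 + (\<Sum>j<n. A $$ (i, j) * x j)"
        by auto
      have r0: "0 < r" using r l0 by simp
      note xp = fixed_point_ge_partial[OF A A0 r0 x i]
      have x1: "1 / r \<le> x i" using xp[of 1] pow_rowsum_0[OF A i] by simp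
      have fst: "(\<Sum>k<k0. ?b k i / r ^ Suc k) \<le> T * x i"
      proof -
        have "(\<Sum>k<k0. ?b k i / r ^ Suc k) \<le> (\<Sum>k<k0. ?b k i / spr B ^ k * (1 / r))"
        proof (rule sum_mono)
          fix k
          have "spr B ^ k \<le> r ^ k" using r l0 by (intro power_mono) auto
          then have "?b k i / r ^ k \<le> ?b k i / spr B ^ k"
            using b0[OF i] r0 l0 by (intro divide_left_mono) auto
          then have "?b k i / r ^ k * (1 / r) \<le> ?b k i / spr B ^ k * (1 / r)"
            using r0 by (intro mult_right_mono) auto
          then show "?b k i / r ^ Suc k \<le> ?b k i / spr B ^ k * (1 / r)" by (simp add: mult.commute)
        qed
        also have "\<dots> = (\<Sum>k<k0. ?b k i / spr B ^ k) * (1 / r)" by (simp only: sum_distrib_right)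
        also have "\<dots> \<le> T * x i" using T[OF i] x1 T0 r0 by (intro mult_mono) auto
        finally show ?thesis .
      qed
      have part: "(\<Sum>k<m. ?b k i / r ^ Suc k) \<le> (T + q) * x i" for m
      proof -
        have "(\<Sum>k<m. ?b k i / r ^ Suc k)
            \<le> (\<Sum>k<m. (if k < k0 then ?b k i / r ^ Suc k else 0) + q * (?a k i / r ^ Suc k))"
        proof (rule sum_mono)
          fix k
          have "0 \<le> q * (?a k i / r ^ Suc k)" using q(1) a0[OF i] r0 by simp
          moreover have "?b k i / r ^ Suc k \<le> q * (?a k i / r ^ Suc k)" if "k0 \<le> k"
            using divide_right_mono[OF ba[OF that i], of "r ^ Suc k"] r0 by simp
          ultimately show "?b k i / r ^ Suc k
              \<le> (if k < k0 then ?b k i / r ^ Suc k else 0) + q * (?a k i / r ^ Suc k)" by simp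
        qed
        also have "\<dots> = (\<Sum>k<m. if k < k0 then ?b k i / r ^ Suc k else 0) + q * (\<Sum>k<m. ?a k i / r ^ Suc k)"
          by (simp only: sum.distrib sum_distrib_left)
        also have "(\<Sum>k<m. if k < k0 then ?b k i / r ^ Suc k else 0)
            = (\<Sum>k\<in>{..<m} \<inter> {..<k0}. ?b k i / r ^ Suc k)"
          by (subst sum.inter_restrict) auto
        also have "\<dots> \<le> (\<Sum>k<k0. ?b k i / r ^ Suc k)"
          using b0[OF i] r0 by (intro sum_mono2) auto
        also have "\<dots> + q * (\<Sum>k<m. ?a k i / r ^ Suc k) \<le> T * x i + q * x i"
          using fst xp[of m] q(1) by (intro add_mono mult_left_mono) auto
        finally show ?thesis by (simp add: distrib_right)
      qed
      show "resolvent_rowsum B r i \<le> (T + q) * x i"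
        unfolding resolvent_rowsum_def
        by (rule suminf_le_const[OF resolvent_summable[OF B B0 n0 r i] part])
    qed
  qed
qed

section \<open>Generalized eigenvectors\<close>

text \<open>Lexicographic nonnegativity becomes coefficientwise: below the lowest term all
  coefficients stay 0, from there on a large \<open>M\<close> makes them positive.\<close>

lemma geom_coeff_nonneg:
  assumes "f = 0 \<or> (\<exists>t. lowest_term f t)"
  shows "\<forall>\<^sub>F M in at_top. \<forall>s. 0 \<le> geom_coeff M f s"
proof (cases "f = 0")
  case False
  then obtain t where t: "lowest_term f t" using assms by auto
  then obtain M0 where M0: "\<And>M s. M0 \<le> M \<Longrightarrow> t \<le> s \<Longrightarrow> 0 < geom_coeff M f s"
    using geom_coeff_pos by blast
  have "geom_coeff M f s = 0" if "s < t" for M s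
    using t that unfolding lowest_term_def by (intro geom_coeff_eq_0) auto
  with M0 show ?thesis unfolding eventually_at_top_linorder by (metis less_imp_le not_less order_refl)
qed (simp add: geom_coeff_0)

text \<open>The componentwise form of the result, with a single \<open>A\<close> attaining all the
  minima.\<close>

lemma minimal_chain:
  assumes n0: "0 < n" and K: "finite K" "K \<noteq> {}" "K \<subseteq> carrier_mat n n"
    and K0: "\<And>A. A \<in> K \<Longrightarrow> nonneg_matrix A"
    and pp: "product_property n K" and l0: "0 < spr B" and min: "growth_minimal n K B"
  obtains w :: "nat \<Rightarrow> nat \<Rightarrow> real" and A where "A \<in> K"
    "\<And>A' i k. \<lbrakk>A' \<in> K; i < n; 1 \<le> k; k \<le> degree_mat B\<rbrakk> \<Longrightarrow>
      (\<Sum>j<n. A $$ (i, j) * w k j) \<le> (\<Sum>j<n. A' $$ (i, j) * w k j)"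
    "\<And>i k. \<lbrakk>i < n; 1 \<le> k; k \<le> degree_mat B\<rbrakk> \<Longrightarrow>
      (\<Sum>j<n. A $$ (i, j) * w k j) = spr B * w k i + (if k < degree_mat B then w (k + 1) i else 0)"
    "\<And>i k. \<lbrakk>i < n; 1 \<le> k; k \<le> state_depth B i\<rbrakk> \<Longrightarrow> 0 < w k i"
    "\<And>i k. \<lbrakk>i < n; state_depth B i < k; k \<le> degree_mat B\<rbrakk> \<Longrightarrow> w k i = 0"
proof -
  let ?l = "spr B" and ?v = "degree_mat B" and ?d = "state_depth B"
  have BK: "B \<in> K" using min unfolding growth_minimal_def by simp
  have B: "B \<in> carrier_mat n n" and B0: "nonneg_matrix B" using BK K(3) K0 by auto
  define eps where "eps k = inverse (real (Suc k))" for k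
  have eps: "0 < eps k" "eps k \<le> 1" for k
  proof -
    show "0 < eps k" unfolding eps_def by simp
    show "eps k \<le> 1" unfolding eps_def by (rule inverse_le_1_iff[THEN iffD2]) simp
  qed
  have eps0: "eps \<longlonglongrightarrow> 0" unfolding eps_def by (rule LIMSEQ_inverse_real_of_nat)
  let ?P = "\<lambda>k A x. A \<in> K \<and> (\<forall>i<n. 0 \<le> x i) \<and> (\<forall>i<n. x i \<le> resolvent_rowsum B (?l + eps k) i)
    \<and> (\<forall>i<n. (?l + eps k) * x i = 1 + (\<Sum>j<n. A $$ (i, j) * x j))
    \<and> (\<forall>A'\<in>K. \<forall>i<n. (\<Sum>j<n. A $$ (i, j) * x j) \<le> (\<Sum>j<n. A' $$ (i, j) * x j))"
  have ex: "\<exists>A x. ?P k A x" for k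
  proof -
    have r: "?l < ?l + eps k" "0 < ?l + eps k" using eps[of k] l0 by auto
    show ?thesis
    proof (rule optimal_fixed_point[OF K K0 pp r(2) BK])
      fix i assume i: "i < n"
      show "0 \<le> resolvent_rowsum B (?l + eps k) i"
        using resolvent_rowsum_pos(2)[OF B B0 n0 r(1) i] by simp
      show "1 + (\<Sum>j<n. B $$ (i, j) * resolvent_rowsum B (?l + eps k) j)
          \<le> (?l + eps k) * resolvent_rowsum B (?l + eps k) i"
        using resolvent_rowsum_eq[OF B B0 n0 r(1) i] by simp
    next
      fix A x
      assume "A \<in> K" "\<And>i. i < n \<Longrightarrow> 0 \<le> x i" "\<And>i. i < n \<Longrightarrow> x i \<le> resolvent_rowsum B (?l + eps k) i"
        "\<And>i. i < n \<Longrightarrow> (?l + eps k) * x i = 1 + (\<Sum>j<n. A $$ (i, j) * x j)"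
        "\<And>A' i. A' \<in> K \<Longrightarrow> i < n \<Longrightarrow> (\<Sum>j<n. A $$ (i, j) * x j) \<le> (\<Sum>j<n. A' $$ (i, j) * x j)"
      then show ?thesis by (intro exI[of _ A] exI[of _ x]) simp
    qed
  qed
  have "\<exists>h. \<forall>k. ?P k (fst (h k)) (snd (h k))"
  proof (rule choice, rule allI)
    fix k
    obtain A x where "?P k A x" using ex[of k] by (elim exE)
    then show "\<exists>h. ?P k (fst h) (snd h)" by (intro exI[of _ "(A, x)"]) simp
  qed
  then obtain h where h: "\<forall>k. ?P k (fst (h k)) (snd (h k))" by (elim exE)
  define Ak where "Ak k = fst (h k)" for k
  define xk where "xk k = snd (h k)" for k
  have P: "?P k (Ak k) (xk k)" for k unfolding Ak_def xk_def using h by (elim allE)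
  have AkK: "Ak k \<in> K" for k using P[of k] by (elim conjE)
  obtain A g where A: "A \<in> K" and g: "strict_mono (g :: nat \<Rightarrow> nat)" and Ag: "\<And>k. Ak (g k) = A"
    using finite_range_constant_subseq[OF K(1), of Ak] AkK by blast
  define e where "e k = eps (g k)" for k
  define x where "x k = xk (g k)" for k
  have e: "0 < e k" "e k \<le> 1" for k unfolding e_def using eps by auto
  have e0: "e \<longlonglongrightarrow> 0" using LIMSEQ_subseq_LIMSEQ[OF eps0 g] by (simp add: e_def[abs_def] o_def)
  have xP: "?P (g k) A (x k)" for k using P[of "g k"] unfolding Ag x_def .
  have x_eq: "(?l + e k) * x k i = 1 + (\<Sum>j<n. A $$ (i, j) * x k j)" if "i < n" for k i
    using xP[of k] that unfolding e_def by blast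
  have x_nonneg: "0 \<le> x k i" if "i < n" for k i using xP[of k] that by blast
  have x_le: "x k i \<le> resolvent_rowsum B (?l + e k) i" if "i < n" for k i
    using xP[of k] that unfolding e_def by blast
  have x_opt: "(\<Sum>j<n. A $$ (i, j) * x k j) \<le> (\<Sum>j<n. A' $$ (i, j) * x k j)" if "A' \<in> K" "i < n" for A' k i
    using xP[of k] that by blast
  have AC: "A \<in> carrier_mat n n" and A0: "nonneg_matrix A" using A K(3) K0 by auto
  \<comment> \<open>Minimality of \<open>B\<close> is applied to the all-ones vector, whose images
    under powers are the row sums.\<close>
  have gl: "growth_le (\<lambda>k. B ^\<^sub>m k *\<^sub>v vec n (\<lambda>_. 1)) (\<lambda>k. A ^\<^sub>m k *\<^sub>v vec n (\<lambda>_. 1))"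
    using min A unfolding growth_minimal_def strictly_pos_vec_def by simp
  obtain C where C: "0 < C"
    "\<forall>r>spr B. \<forall>x. (\<forall>i<n. 0 \<le> x i \<and> r * x i = 1 + (\<Sum>j<n. A $$ (i, j) * x j)) \<longrightarrow>
      (\<forall>i<n. resolvent_rowsum B r i \<le> C * x i)"
    by (rule resolvent_le_of_growth[OF AC A0 B B0 n0 l0 gl], rule that)
  obtain c c' where c: "0 < c"
    "\<And>e i. \<lbrakk>0 < e; e \<le> 1; i < n\<rbrakk> \<Longrightarrow> c / e ^ ?d i \<le> resolvent_rowsum B (?l + e) i"
    "\<And>e i. \<lbrakk>0 < e; e \<le> 1; i < n\<rbrakk> \<Longrightarrow> resolvent_rowsum B (?l + e) i \<le> c' / e ^ ?d i"
    using resolvent_growth[OF B B0 n0] by blast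
  have lo: "c / C / e k ^ ?d i \<le> x k i" if i: "i < n" for k i
  proof -
    have "resolvent_rowsum B (?l + e k) i \<le> C * x k i"
      using C(2)[rule_format, of "?l + e k" "x k" i] x_eq x_nonneg e(1)[of k] i by simp
    with c(2)[OF e i] have "c / e k ^ ?d i \<le> x k i * C" by (simp only: mult.commute) (meson order_trans)
    then have "c / e k ^ ?d i / C \<le> x k i" using C(1) by (simp only: pos_divide_le_eq)
    then show ?thesis by (simp only: divide_divide_eq_left mult.commute)
  qed
  have up: "x k i \<le> c' / e k ^ ?d i" if "i < n" for k i
    using x_le[OF that, of k] c(3)[OF e that] by (rule order_trans)
  have cC: "0 < c / C" using c(1) C(1) by simp
  show thesis
  proof (rule resolvent_polynomials[OF AC e0 e(1) x_eq cC lo up state_depth_le_degree[OF B B0]])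
    fix p q m
    assume vm: "?v \<le> m" and q0: "\<And>j. j < m \<Longrightarrow> coeff q j = 0"
      and p: "\<And>i. i < n \<Longrightarrow> [:?l, 1:] * p i = q + (\<Sum>j<n. Polynomial.smult (A $$ (i, j)) (p j))"
      and pl: "\<And>i. i < n \<Longrightarrow> lowest_term (p i) (m - ?d i)"
      and qp: "\<forall>\<^sub>F k in sequentially. 0 < poly q (e k)"
      and px: "\<And>k i. i < n \<Longrightarrow> poly (p i) (e k) = poly q (e k) * x k i"
    \<comment> \<open>The components of (A' - A) p. Optimality of \<open>A\<close> at the points
      \<open>x k\<close> makes them nonnegative along \<open>e\<close>.\<close>
    define f where "f A' i = (\<Sum>j<n. Polynomial.smult (A' $$ (i, j) - A $$ (i, j)) (p j))" for A' i
    have fl: "f A' i = 0 \<or> (\<exists>t. lowest_term (f A' i) t)" if A': "A' \<in> K" and i: "i < n" for A' i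
    proof (cases "f A' i = 0")
      case False
      have "\<forall>\<^sub>F k in sequentially. 0 \<le> poly (f A' i) (e k)"
        using qp
      proof eventually_elim
        case (elim k)
        have "poly (f A' i) (e k)
            = poly q (e k) * ((\<Sum>j<n. A' $$ (i, j) * x k j) - (\<Sum>j<n. A $$ (i, j) * x k j))"
          unfolding f_def by (simp add: poly_sum px sum_distrib_left flip: sum_subtractf)
            (simp add: algebra_simps)
        then show ?case using elim x_opt[OF A' i, of k] by simp
      qed
      from lowest_term_if_nonneg[OF e0 e(1) False this] show ?thesis by blast
    qed simp
    \<comment> \<open>Only finitely many polynomials are involved, so one \<open>M\<close> serves
      all of them.\<close>
    have "\<forall>\<^sub>F M in at_top. (\<forall>A'\<in>K. \<forall>i\<in>{..<n}. \<forall>s. 0 \<le> geom_coeff M (f A' i) s) \<and>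
        (\<forall>i\<in>{..<n}. \<forall>s\<ge>m - ?d i. 0 < geom_coeff M (p i) s)"
    proof (intro eventually_conj eventually_ball_finite ballI K(1) finite_lessThan)
      fix A' i assume "A' \<in> K" "i \<in> {..<n}"
      then show "\<forall>\<^sub>F M in at_top. \<forall>s. 0 \<le> geom_coeff M (f A' i) s"
        by (intro geom_coeff_nonneg fl) auto
    next
      fix i assume "i \<in> {..<n}"
      then show "\<forall>\<^sub>F M in at_top. \<forall>s\<ge>m - ?d i. 0 < geom_coeff M (p i) s"
        using geom_coeff_pos[OF pl] unfolding eventually_at_top_linorder by auto
    qed
    then obtain M where "(\<forall>A'\<in>K. \<forall>i\<in>{..<n}. \<forall>s. 0 \<le> geom_coeff M (f A' i) s) \<and>
        (\<forall>i\<in>{..<n}. \<forall>s\<ge>m - ?d i. 0 < geom_coeff M (p i) s)"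
      by (rule exE[OF eventually_happens'[OF trivial_limit_at_top_linorder]])
    then have M: "\<And>A' i s. A' \<in> K \<Longrightarrow> i < n \<Longrightarrow> 0 \<le> geom_coeff M (f A' i) s"
      "\<And>i s. i < n \<Longrightarrow> m - ?d i \<le> s \<Longrightarrow> 0 < geom_coeff M (p i) s"
      by auto
    have low: "geom_coeff M (p i) s = 0" if "i < n" "s < m - ?d i" for i s
      using pl[OF that(1)] that(2) unfolding lowest_term_def by (intro geom_coeff_eq_0) auto
    \<comment> \<open>Counting down from \<open>m\<close> turns multiplication by e into the step
      from \<open>k\<close> to \<open>k + 1\<close>.\<close>
    define w where "w k i = geom_coeff M (p i) (m - k)" for k i
    show thesis
    proof (rule that[OF A, of w])
      fix A' i k assume *: "A' \<in> K" "i < n" "1 \<le> k" "k \<le> ?v"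
      have "geom_coeff M (f A' i) (m - k) = (\<Sum>j<n. A' $$ (i, j) * w k j) - (\<Sum>j<n. A $$ (i, j) * w k j)"
        unfolding f_def w_def by (simp add: geom_coeff_sum geom_coeff_smult left_diff_distrib sum_subtractf)
      with M(1)[OF *(1,2), of "m - k"]
      show "(\<Sum>j<n. A $$ (i, j) * w k j) \<le> (\<Sum>j<n. A' $$ (i, j) * w k j)" by simp
    next
      fix i k assume i: "i < n" and k: "1 \<le> k" "k \<le> ?v"
      have "geom_coeff M ([:?l, 1:] * p i) (m - k) = geom_coeff M q (m - k) + (\<Sum>j<n. A $$ (i, j) * w k j)"
        unfolding p[OF i] w_def by (simp add: geom_coeff_add geom_coeff_sum geom_coeff_smult)
      \<comment> \<open>As \<open>k >= 1\<close>, the index is below the order \<open>m\<close> of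
        \<open>q\<close>, and the inhomogeneous term disappears.\<close>
      moreover have "geom_coeff M q (m - k) = 0"
        using q0 k vm by (intro geom_coeff_eq_0) auto
      moreover have "(case m - k of 0 \<Rightarrow> 0 | Suc s \<Rightarrow> geom_coeff M (p i) s)
          = (if k < ?v then w (k + 1) i else 0)"
      proof (cases "k < ?v")
        case True
        with vm have "m - k = Suc (m - (k + 1))" by simp
        then show ?thesis using True by (simp add: w_def)
      next
        case False
        \<comment> \<open>At \<open>k = ?v\<close> the next index \<open>m - ?v - 1\<close>, if
          there is one, lies below every \<open>m - ?d i\<close>; this ends the chain.\<close>
        have "?d i \<le> ?v" by (rule state_depth_le_degree[OF B B0 i])
        then have "geom_coeff M (p i) s = 0" if "m - k = Suc s" for s
          using that False k by (intro low[OF i]) auto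
        then show ?thesis using False by (simp split: nat.split)
      qed
      ultimately show "(\<Sum>j<n. A $$ (i, j) * w k j) = ?l * w k i + (if k < ?v then w (k + 1) i else 0)"
        unfolding geom_coeff_linear_mult by (simp add: w_def)
    next
      fix i k assume "i < n" "1 \<le> k" "k \<le> ?d i"
      then show "0 < w k i" unfolding w_def by (intro M(2)) auto
    next
      fix i k assume i: "i < n" and "?d i < k" "k \<le> ?v"
      then show "w k i = 0" unfolding w_def using vm by (intro low) auto
    qed
  qed
qed

lemma min_mult_vec_eqI:
  assumes K: "finite K" "K \<subseteq> carrier_mat n n" and A: "A \<in> K" and v: "v \<in> carrier_vec n"
    and u: "u \<in> carrier_vec n" "\<And>i. i < n \<Longrightarrow> (\<Sum>j<n. A $$ (i, j) * v $ j) = u $ i"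
    and le: "\<And>A' i. A' \<in> K \<Longrightarrow> i < n \<Longrightarrow>
      (\<Sum>j<n. A $$ (i, j) * v $ j) \<le> (\<Sum>j<n. A' $$ (i, j) * v $ j)"
  shows "min_mult_vec n K v = u"
proof (rule eq_vecI)
  fix i assume "i < dim_vec u"
  then have i: "i < n" using u by simp
  have ent: "(A' *\<^sub>v v) $ i = (\<Sum>j<n. A' $$ (i, j) * v $ j)" if "A' \<in> K" for A'
    using mult_mat_vec_entry[OF _ v i] K(2) that by blast
  have "Min ((\<lambda>A. (A *\<^sub>v v) $ i) ` K) = u $ i"
  proof (rule Min_eqI)
    show "u $ i \<in> (\<lambda>A. (A *\<^sub>v v) $ i) ` K"
      by (rule image_eqI[OF _ A]) (simp add: ent[OF A] u(2)[OF i])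
    show "u $ i \<le> y" if "y \<in> (\<lambda>A. (A *\<^sub>v v) $ i) ` K" for y
      using that le[OF _ i] ent u(2)[OF i] by auto
  qed (use K(1) in simp)
  then show "min_mult_vec n K v $ i = u $ i" unfolding min_mult_vec_def using i by simp
qed (use u in \<open>simp add: min_mult_vec_def\<close>)

theorem theorem10:
  fixes N :: nat and K :: "real mat set" and B :: "real mat"
  assumes "N \<ge> 1"
    and "finite K" and "K \<noteq> {}"
    and "K \<subseteq> carrier_mat N N"
    and "\<And>A. A \<in> K \<Longrightarrow> nonneg_matrix A"
    and "product_property N K"
    and "\<And>A. A \<in> K \<Longrightarrow> spr A > 0"
    and "growth_minimal N K B"
  shows "\<exists>v :: nat \<Rightarrow> real vec.
    (\<forall>i\<in>{1..degree_mat B}. v i \<in> carrier_vec N \<and> nonneg_vec (v i)) \<and>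
    min_mult_vec N K (v (degree_mat B)) = spr B \<cdot>\<^sub>v v (degree_mat B) \<and>
    (\<forall>i\<in>{1..<degree_mat B}. min_mult_vec N K (v i) = spr B \<cdot>\<^sub>v v i + v (i + 1)) \<and>
    (\<forall>i\<in>{1..degree_mat B}.
       (\<forall>j\<in>(\<Union>k\<in>{i..degree_mat B}. principal_part B k). v i $ j > 0) \<and>
       (\<forall>j\<in>(\<Union>k\<in>{0..i-1}. principal_part B k). v i $ j = 0))"
proof -
  let ?v = "degree_mat B" and ?l = "spr B"
  have BK: "B \<in> K" using assms(8) unfolding growth_minimal_def by simp
  then have B: "B \<in> carrier_mat N N" and B0: "nonneg_matrix B" and l0: "0 < ?l"
    using assms(4,5,7) by auto
  have N: "0 < N" using assms(1) by simp
  show ?thesis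
  proof (rule minimal_chain[OF N assms(2-6) l0 assms(8)])
    fix w A assume A: "A \<in> K"
      and opt: "\<And>A' i k. \<lbrakk>A' \<in> K; i < N; 1 \<le> k; k \<le> ?v\<rbrakk> \<Longrightarrow>
        (\<Sum>j<N. A $$ (i, j) * w k j) \<le> (\<Sum>j<N. A' $$ (i, j) * w k j)"
      and eq: "\<And>i k. \<lbrakk>i < N; 1 \<le> k; k \<le> ?v\<rbrakk> \<Longrightarrow>
        (\<Sum>j<N. A $$ (i, j) * w k j) = ?l * w k i + (if k < ?v then w (k + 1) i else 0)"
      and pos: "\<And>i k. \<lbrakk>i < N; 1 \<le> k; k \<le> state_depth B i\<rbrakk> \<Longrightarrow> (0::real) < w k i"
      and zero: "\<And>i k. \<lbrakk>i < N; state_depth B i < k; k \<le> ?v\<rbrakk> \<Longrightarrow> w k i = 0"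
    \<comment> \<open>In the degenerate case \<open>degree_mat B = 0\<close> the second conjunct still constrains \<open>v 0\<close>.\<close>
    define v where "v k = vec N (\<lambda>i. if k = 0 then 0 else w k i)" for k
    have vk: "v k \<in> carrier_vec N" and vi: "i < N \<Longrightarrow> v k $ i = (if k = 0 then 0 else w k i)" for k i
      unfolding v_def by auto
    have part: "principal_part B k = {i. i < N \<and> state_depth B i = k}" for k
      by (rule principal_part_eq[OF B B0])
    \<comment> \<open>One form for all the equations: the shifted term is absent at
      \<open>k = ?v\<close>, and for \<open>k = 0\<close> both sides vanish.\<close>
    have min: "min_mult_vec N K (v k) = u"
      if "k \<le> ?v" "u \<in> carrier_vec N"
        "\<And>i. i < N \<Longrightarrow> u $ i = (if k = 0 then 0 else ?l * w k i + (if k < ?v then w (k + 1) i else 0))"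
      for k u
    proof (rule min_mult_vec_eqI[OF assms(2,4) A vk that(2)])
      fix i assume i: "i < N"
      show "(\<Sum>j<N. A $$ (i, j) * v k $ j) = u $ i"
        using that(1) that(3)[OF i] eq[OF i, of k] by (cases "k = 0") (simp_all add: vi)
      fix A' assume "A' \<in> K"
      then show "(\<Sum>j<N. A $$ (i, j) * v k $ j) \<le> (\<Sum>j<N. A' $$ (i, j) * v k $ j)"
        using that(1) opt[OF _ i, of A' k] by (cases "k = 0") (simp_all add: vi)
    qed
    show ?thesis
    proof (intro exI[of _ v] conjI ballI)
      fix k assume k: "k \<in> {1..?v}"
      show "v k \<in> carrier_vec N" by (rule vk)
      have "0 \<le> w k i" if "i < N" for i
        using pos[OF that, of k] zero[OF that, of k] k by (cases "k \<le> state_depth B i") auto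
      then show "nonneg_vec (v k)"
        unfolding nonneg_vec_def less_eq_vec_def using vk[of k] k by (auto simp: vi)
      fix j
      show "0 < v k $ j" if "j \<in> (\<Union>k\<in>{k..?v}. principal_part B k)"
        using that k pos[of j k] by (auto simp: part vi)
      show "v k $ j = 0" if "j \<in> (\<Union>k\<in>{0..k - 1}. principal_part B k)"
        using that k zero[of j k] by (auto simp: part vi)
    next
      show "min_mult_vec N K (v ?v) = ?l \<cdot>\<^sub>v v ?v"
        by (rule min) (use vk[of ?v] in \<open>auto simp: vi\<close>)
    next
      fix k assume k: "k \<in> {1..<?v}"
      show "min_mult_vec N K (v k) = ?l \<cdot>\<^sub>v v k + v (k + 1)"
        by (rule min) (use vk[of k] vk[of "k + 1"] k in \<open>auto simp: vi\<close>)
    qed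
  qed
qed

end
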